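(* Let $\mathcal{G}$ be the AMP Markov equivalence class of a chain graph and $\mathcal{G}^*$ its AMP essential graph. Then $\mathcal{G}$ contains some ADG $D_0$ iff $\mathcal{G}^*$ has no biflags and all its chain components are chordal. In this case $\mathcal{G}^*=\mathcal{D}^*$, where $\mathcal{D}$ is the ADG Markov equivalence class containing $D_0$ and $\mathcal{D}^*$ its ADG essential graph.
   Context: All graphs are finite; between two distinct vertices there is at most one edge, which is either a line $a-b$ or an arrow $a\to b$. $a\Rightarrow b$ means $a\to b$ or $a-b$. A $k$-cycle ($k\ge 3$) is a sequence $(v_0,\dots,v_k=v_0)$, with $v_0,\dots,v_{k-1}$ distinct, such that $v_{i-1}\Rightarrow v_i$ for all $i$; it is semi-directed if at least one of these edges is an arrow. A chain graph (CG) is an adicyclic graph, i.e., one with no semi-directed cycles. An ADG is an acyclic directed graph. The skeleton is the graph obtained by forgetting orientations. A triplex $(\{a,c\},b)$ occurs in a graph if $a,c$ are nonadjacent and the induced subgraph on $\{a,b,c\}$ is $a\to b\leftarrow c$ (an immorality), or $a\to b-c$ or $a-b\leftarrow c$ (flags). Two CGs on the same vertex set are AMP Markov equivalent if they determine the same set of distributions under the AMP Markov property; by a known theorem this holds iff they have the same skeleton and the same triplexes, which may be taken as the definition. The AMP essential graph $\mathcal{G}^*$ has the common skeleton of the members of $\mathcal{G}$; an arrow $a\to b$ occurs in $\mathcal{G}^*$ iff $a\to b\in G$ for at least one $G\in\mathcal{G}$ but $a\leftarrow b\in G'$ for no $G'\in\mathcal{G}$; every other edge of the skeleton is a line in $\mathcal{G}^*$.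 It is known that $\mathcal{G}^*$ is itself a CG belonging to $\mathcal{G}$. Two ADGs are Markov equivalent iff they have the same skeleton and the same immoralities. $\mathcal{D}^*=\bigcup\{D\mid D\in\mathcal{D}\}$ has the common skeleton, with $a\to b\in\mathcal{D}^*$ iff $a\to b\in D$ for all $D\in\mathcal{D}$, and with $a-b\in\mathcal{D}^*$ iff $a\to b$ and $a\leftarrow b$ occur in two different members of $\mathcal{D}$. Chain components of a CG are the connected components obtained after removing all arrows. An undirected graph is chordal if it has no chordless cycles (of length $\geq 4$); a chain component is chordal if the subgraph it induces is. Biflags. A $k$-biflag is an induced subgraph of one of two types, in which $c_1-c_2-\cdots-c_k$ is a chordless undirected path. Type $[a;c_1,\dots,c_k]$ ($k\ge3$): $a\to c_i$ for $i=2,\dots,k-1$, and $a$ is nonadjacent to $c_1$ and $c_k$. Type $[a,b;c_1,\dots,c_k]$ ($k\ge2$, $a\ne b$): $a\to c_i$ for $i=1,\dots,k-1$, $a$ nonadjacent to $c_k$; $b\to c_i$ for $i=2,\dots,k$, $b$ nonadjacent to $c_1$; $a$ and $b$ may be nonadjacent or joined by any edge. A biflag is a $k$-biflag for some $k$. *)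

theory Defs
  imports Main
begin

record 'a mixed_graph =
  verts  :: "'a set"
  arrows :: "('a \<times> 'a) set"
  lines  :: "('a \<times> 'a) set"

text \<open>A line \<open>a - b\<close> is stored as both \<open>(a, b)\<close> and \<open>(b, a)\<close>; asymmetry of \<open>arrows\<close> and
  disjointness from \<open>lines\<close> say that two vertices are joined by at most one edge.\<close>

definition mixed_graph :: "'a mixed_graph \<Rightarrow> bool" where
  "mixed_graph G \<longleftrightarrow> finite (verts G)
     \<and> arrows G \<subseteq> verts G \<times> verts G \<and> lines G \<subseteq> verts G \<times> verts G
     \<and> asym (arrows G) \<and> irrefl (lines G) \<and> sym (lines G)
     \<and> arrows G \<inter> lines G = {}"

definition step :: "'a mixed_graph \<Rightarrow> 'a \<Rightarrow> 'a \<Rightarrow> bool" where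
  "step G a b \<longleftrightarrow> (a, b) \<in> arrows G \<or> (a, b) \<in> lines G"

definition adj :: "'a mixed_graph \<Rightarrow> 'a \<Rightarrow> 'a \<Rightarrow> bool" where
  "adj G a b \<longleftrightarrow> (a, b) \<in> arrows G \<or> (b, a) \<in> arrows G \<or> (a, b) \<in> lines G"

definition skeleton :: "'a mixed_graph \<Rightarrow> 'a mixed_graph" where
  "skeleton G = \<lparr>verts = verts G, arrows = {}, lines = {(a, b). adj G a b}\<rparr>"

definition induced :: "'a mixed_graph \<Rightarrow> 'a set \<Rightarrow> 'a mixed_graph" where
  "induced G A = \<lparr>verts = verts G \<inter> A, arrows = arrows G \<inter> A \<times> A, lines = lines G \<inter> A \<times> A\<rparr>"

text \<open>The cycle \<open>(v\<^sub>0, \<dots>, v\<^sub>k = v\<^sub>0)\<close> is represented by the list \<open>[v\<^sub>0, \<dots>, v\<^bsub>k-1\<^esub>]\<close>.\<close>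

definition is_cycle :: "'a mixed_graph \<Rightarrow> 'a list \<Rightarrow> bool" where
  "is_cycle G vs \<longleftrightarrow> 3 \<le> length vs \<and> distinct vs
     \<and> (\<forall>i<length vs. step G (vs ! i) (vs ! (Suc i mod length vs)))"

definition semi_directed_cycle :: "'a mixed_graph \<Rightarrow> 'a list \<Rightarrow> bool" where
  "semi_directed_cycle G vs \<longleftrightarrow> is_cycle G vs
     \<and> (\<exists>i<length vs. (vs ! i, vs ! (Suc i mod length vs)) \<in> arrows G)"

definition chain_graph :: "'a mixed_graph \<Rightarrow> bool" where
  "chain_graph G \<longleftrightarrow> mixed_graph G \<and> \<not> (\<exists>vs. semi_directed_cycle G vs)"

definition ADG :: "'a mixed_graph \<Rightarrow> bool" where
  "ADG G \<longleftrightarrow> mixed_graph G \<and> lines G = {} \<and> \<not> (\<exists>vs. is_cycle G vs)"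

definition immoralities :: "'a mixed_graph \<Rightarrow> ('a set \<times> 'a) set" where
  "immoralities G = {({a, c}, b) | a b c. a \<noteq> c \<and> \<not> adj G a c
     \<and> (a, b) \<in> arrows G \<and> (c, b) \<in> arrows G}"

text \<open>In the second set \<open>a\<close> and \<open>c\<close> range over all ordered pairs, so it contains both kinds of
  flags, \<open>a \<rightarrow> b - c\<close> and \<open>a - b \<leftarrow> c\<close>.\<close>

definition triplexes :: "'a mixed_graph \<Rightarrow> ('a set \<times> 'a) set" where
  "triplexes G = immoralities G \<union>
     {({a, c}, b) | a b c. a \<noteq> c \<and> \<not> adj G a c \<and> (a, b) \<in> arrows G \<and> (b, c) \<in> lines G}"

text \<open>Markov equivalence is taken in its graphical form. Equality of skeletons includes equality
  of vertex sets.\<close>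

definition amp_class :: "'a mixed_graph \<Rightarrow> 'a mixed_graph set" where
  "amp_class G = {H. chain_graph H \<and> skeleton H = skeleton G \<and> triplexes H = triplexes G}"

definition adg_class :: "'a mixed_graph \<Rightarrow> 'a mixed_graph set" where
  "adg_class D = {H. ADG H \<and> skeleton H = skeleton D \<and> immoralities H = immoralities D}"

text \<open>Both essential graphs are only meant for classes whose members share a skeleton, so the
  unions and existentials below just extract the common vertex set and the common adjacencies.\<close>

definition amp_essential_arrows :: "'a mixed_graph set \<Rightarrow> ('a \<times> 'a) set" where
  "amp_essential_arrows \<C> =
     {(a, b). (\<exists>G\<in>\<C>. (a, b) \<in> arrows G) \<and> \<not> (\<exists>G\<in>\<C>. (b, a) \<in> arrows G)}"

definition amp_essential_graph :: "'a mixed_graph set \<Rightarrow> 'a mixed_graph" where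
  "amp_essential_graph \<C> = \<lparr>verts = (\<Union>G\<in>\<C>. verts G),
     arrows = amp_essential_arrows \<C>,
     lines = {(a, b). (\<exists>G\<in>\<C>. adj G a b)
                \<and> (a, b) \<notin> amp_essential_arrows \<C> \<and> (b, a) \<notin> amp_essential_arrows \<C>}\<rparr>"

definition adg_essential_graph :: "'a mixed_graph set \<Rightarrow> 'a mixed_graph" where
  "adg_essential_graph \<D> = \<lparr>verts = (\<Union>D\<in>\<D>. verts D),
     arrows = {(a, b). \<forall>D\<in>\<D>. (a, b) \<in> arrows D},
     lines = {(a, b). (\<exists>D\<in>\<D>. (a, b) \<in> arrows D) \<and> (\<exists>D\<in>\<D>. (b, a) \<in> arrows D)}\<rparr>"

definition chain_components :: "'a mixed_graph \<Rightarrow> 'a set set" where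
  "chain_components G = {(lines G)\<^sup>* `` {v} | v. v \<in> verts G}"

definition chordless_cycle :: "'a mixed_graph \<Rightarrow> 'a list \<Rightarrow> bool" where
  "chordless_cycle G vs \<longleftrightarrow> is_cycle G vs
     \<and> (\<forall>i<length vs. \<forall>j<length vs. adj G (vs ! i) (vs ! j)
          \<longrightarrow> j = Suc i mod length vs \<or> i = Suc j mod length vs)"

text \<open>Only used for undirected graphs: the subgraph induced on a chain component of a chain graph
  has no arrows.\<close>

definition chordal :: "'a mixed_graph \<Rightarrow> bool" where
  "chordal G \<longleftrightarrow> \<not> (\<exists>vs. 4 \<le> length vs \<and> chordless_cycle G vs)"

definition chordless_undirected_path :: "'a mixed_graph \<Rightarrow> 'a list \<Rightarrow> bool" where
  "chordless_undirected_path G cs \<longleftrightarrow> distinct cs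
     \<and> (\<forall>i. Suc i < length cs \<longrightarrow> (cs ! i, cs ! Suc i) \<in> lines G)
     \<and> (\<forall>i<length cs. \<forall>j<length cs. adj G (cs ! i) (cs ! j) \<longrightarrow> j = Suc i \<or> i = Suc j)"

text \<open>The biflags \<open>[a; c\<^sub>1, \<dots>, c\<^sub>k]\<close> and \<open>[a, b; c\<^sub>1, \<dots>, c\<^sub>k]\<close>; list indices start at 0, so
  \<open>c\<^sub>i\<close> is \<open>cs ! (i - 1)\<close>.\<close>

definition biflag1 :: "'a mixed_graph \<Rightarrow> 'a \<Rightarrow> 'a list \<Rightarrow> bool" where
  "biflag1 G a cs \<longleftrightarrow> 3 \<le> length cs \<and> chordless_undirected_path G cs \<and> a \<notin> set cs
     \<and> (\<forall>i. 0 < i \<and> i < length cs - 1 \<longrightarrow> (a, cs ! i) \<in> arrows G)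
     \<and> \<not> adj G a (cs ! 0) \<and> \<not> adj G a (cs ! (length cs - 1))"

definition biflag2 :: "'a mixed_graph \<Rightarrow> 'a \<Rightarrow> 'a \<Rightarrow> 'a list \<Rightarrow> bool" where
  "biflag2 G a b cs \<longleftrightarrow> 2 \<le> length cs \<and> chordless_undirected_path G cs
     \<and> a \<noteq> b \<and> a \<notin> set cs \<and> b \<notin> set cs
     \<and> (\<forall>i. i < length cs - 1 \<longrightarrow> (a, cs ! i) \<in> arrows G) \<and> \<not> adj G a (cs ! (length cs - 1))
     \<and> (\<forall>i. 0 < i \<and> i < length cs \<longrightarrow> (b, cs ! i) \<in> arrows G) \<and> \<not> adj G b (cs ! 0)"

definition has_biflag :: "'a mixed_graph \<Rightarrow> bool" where
  "has_biflag G \<longleftrightarrow> (\<exists>a cs. biflag1 G a cs) \<or> (\<exists>a b cs. biflag2 G a b cs)"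

end

theory Submission
  imports Defs
begin

text \<open>Call an edge rigid if it is the same line or the same arrow in all members of the class.

  Suppose first that the class contains an ADG \<open>D\<close>. In any member \<open>H\<close>, orient the lines as \<open>D\<close>
  does and keep the arrows. A directed cycle of the result would be a semi-directed cycle of \<open>H\<close> or
  a directed cycle of \<open>D\<close>, and since the flags of \<open>H\<close> are immoralities of \<open>D\<close>, the triplexes do not
  change (\<open>orient_lines_like_ADG\<close>). So every arrow of a member already occurs in an ADG of the class,
  which means that the two essential graphs agree (\<open>essential_graph_of_ADG\<close>). An ADG essential graph
  has no flags: if \<open>a \<rightarrow> b - c\<close> is one, the line is \<open>c \<rightarrow> b\<close> in some ADG of the class and the triplex
  at \<open>b\<close> forbids \<open>b \<rightarrow> c\<close> in the others. Every biflag contains a flag, so there are no biflags. Nor is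
  there a chordless cycle of length at least 4: in an ADG it has a sink, which is an immorality, so
  that the essential graph has arrows meeting at this vertex.

  For the converse, the edges of a chordless cycle of lines are rigid, and so are the path in a
  biflag and the arrows to it. Along a path whose
  consecutive triples are unshielded and not triplexes, one arrow forces all later edges to be arrows
  in the same direction. On a cycle that closes up to a directed cycle, and on a biflag it
  contradicts the triplex at the far end. Hence a biflag or a chordless cycle of lines in any
  member survives in the essential graph (\<open>biflag_in_essential_graph\<close>, \<open>hole_in_essential_graph\<close>),
  and it suffices to find an ADG in a class whose members all avoid them. Such a class lets one
  remove lines step by step: a member with a line has a vertex \<open>v\<close> such that turning all lines at
  \<open>v\<close> into arrows to \<open>v\<close> gives another member (\<open>orient_lines_into_vertex\<close>). This is so if the
  neighbours of \<open>v\<close> by lines are pairwise adjacent and all their parents are parents of \<open>v\<close>.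
  To find \<open>v\<close> (\<open>orientable_vertex\<close>), take a maximal connected set \<open>K\<close>
  of vertices with the same, largest possible, set of parents. A missing edge in the boundary of
  \<open>K\<close> would give a biflag along a shortest path through \<open>K\<close>, so the boundary is a clique, and a
  chordal graph has a simplicial vertex outside any clique that is not the whole graph
  (\<open>simplicial_vertex_outside_clique\<close>).\<close>

section \<open>Shortest paths\<close>

lemma shortest_path:
  assumes "(u, w) \<in> R\<^sup>*"
  obtains f and n :: nat where "f 0 = u" "f n = w" "\<And>i. i < n \<Longrightarrow> (f i, f (Suc i)) \<in> R"
    "inj_on f {..n}" "\<And>i j. i < j \<Longrightarrow> j \<le> n \<Longrightarrow> (f i, f j) \<in> R \<Longrightarrow> j = Suc i"
proof -
  \<comment> \<open>Repeated vertices and chords would allow a walk with fewer than \<open>n\<close> steps.\<close>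
  define n where "n = (LEAST n. (u, w) \<in> R ^^ n)"
  have ex: "\<exists>n. (u, w) \<in> R ^^ n" using assms by (simp add: rtrancl_power)
  have n: "(u, w) \<in> R ^^ n" unfolding n_def using LeastI_ex[OF ex] .
  have least: "n \<le> m" if "(u, w) \<in> R ^^ m" for m unfolding n_def using that by (rule Least_le)
  obtain f where f: "f 0 = u" "f n = w" "\<And>i. i < n \<Longrightarrow> (f i, f (Suc i)) \<in> R"
    using n unfolding relpow_fun_conv by blast
  have seg: "(f i, f (i + k)) \<in> R ^^ k" if "i + k \<le> n" for i k
    using that by (induction k) (auto intro!: f(3))
  have pre: "(u, f i) \<in> R ^^ i" if "i \<le> n" for i using seg[of 0 i] that f(1) by simp
  have suf: "(f j, w) \<in> R ^^ (n - j)" if "j \<le> n" for j using seg[of j "n - j"] that f(2) by simp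
  have ne: "f i \<noteq> f j" if "i < j" "j \<le> n" for i j
  proof
    assume "f i = f j"
    then have "(u, w) \<in> R ^^ i O R ^^ (n - j)" using pre[of i] suf[of j] that by auto
    then have "(u, w) \<in> R ^^ (i + (n - j))" by (simp add: relpow_add)
    from least[OF this] that show False by linarith
  qed
  have short: "j = Suc i" if "i < j" "j \<le> n" "(f i, f j) \<in> R" for i j
  proof -
    have "(u, f j) \<in> R ^^ Suc i" using pre[of i] that by auto
    then have "(u, w) \<in> R ^^ Suc i O R ^^ (n - j)" using suf[of j] that by blast
    then have "(u, w) \<in> R ^^ (Suc i + (n - j))" unfolding relpow_add .
    from least[OF this] that show ?thesis by linarith
  qed
  have "inj_on f {..n}"
    by (rule inj_onI) (metis atMost_iff linorder_neqE_nat ne)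
  with f short show thesis by (intro that[of f n]) auto
qed

text \<open>Two nonadjacent vertices on the boundary of a connected set are joined by a chordless path with
  interior in that set. Applied to the boundary of a component of a vertex set it closes up to a hole,
  applied to vertices with the same parents it carries a biflag.\<close>

lemma shortest_path_through:
  assumes "sym E" "irrefl E"
    and conn: "\<And>c d. c \<in> C \<Longrightarrow> d \<in> C \<Longrightarrow> (c, d) \<in> (E \<inter> C \<times> C)\<^sup>*"
    and "c \<in> C" "(c, y) \<in> E" "d \<in> C" "(d, z) \<in> E" "y \<noteq> z" "(y, z) \<notin> E"
  obtains f and n :: nat where "2 \<le> n" "f 0 = y" "f n = z" "inj_on f {..n}"
    "\<And>i. 0 < i \<Longrightarrow> i < n \<Longrightarrow> f i \<in> C" "\<And>i. i < n \<Longrightarrow> (f i, f (Suc i)) \<in> E"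
    "\<And>i j. i \<le> n \<Longrightarrow> j \<le> n \<Longrightarrow> (f i, f j) \<in> E \<Longrightarrow> j = Suc i \<or> i = Suc j"
proof -
  define A where "A = insert y (insert z C)"
  define R where "R = E \<inter> A \<times> A"
  have "(c, d) \<in> R\<^sup>*"
    using conn[OF assms(4,6)] rtrancl_mono[of "E \<inter> C \<times> C" R] by (auto simp: R_def A_def)
  moreover have "(y, c) \<in> R" "(d, z) \<in> R"
    using assms by (auto simp: R_def A_def dest: symD)
  ultimately have "(y, z) \<in> R\<^sup>*"
    by (meson converse_rtrancl_into_rtrancl rtrancl.rtrancl_into_rtrancl)
  then obtain f n where f: "f 0 = y" "f n = z" "\<And>i. i < n \<Longrightarrow> (f i, f (Suc i)) \<in> R"
    "inj_on f {..n}" "\<And>i j. i < j \<Longrightarrow> j \<le> n \<Longrightarrow> (f i, f j) \<in> R \<Longrightarrow> j = Suc i"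
    by (rule shortest_path) blast
  have inA: "f i \<in> A" if "i \<le> n" for i
    using that f(2) f(3)[of i] by (cases "i = n") (auto simp: R_def A_def)
  have n2: "2 \<le> n"
  proof (rule ccontr)
    assume "\<not> 2 \<le> n"
    then have "n = 0 \<or> n = 1" by linarith
    then show False using f(1-3) assms by (auto simp: R_def)
  qed
  have "f i \<in> C" if "0 < i" "i < n" for i
  proof -
    have "f i \<noteq> f 0" "f i \<noteq> f n" using inj_onD[OF f(4)] that by force+
    then show ?thesis using inA[of i] that f(1,2) by (auto simp: A_def)
  qed
  moreover have "j = Suc i \<or> i = Suc j" if "i \<le> n" "j \<le> n" "(f i, f j) \<in> E" for i j
  proof -
    have "(f i, f j) \<in> R" "(f j, f i) \<in> R" using that inA assms(1) by (auto simp: R_def dest: symD)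
    moreover have "i \<noteq> j" using that assms(2) by (auto dest: irreflD)
    ultimately show ?thesis using f(5) that by (meson linorder_neqE_nat)
  qed
  ultimately show thesis using that[of n f] n2 f by (auto simp: R_def)
qed

lemma reachable_set_connected:
  assumes "sym E" "c \<in> (E \<inter> M \<times> M)\<^sup>* `` {t}" "d \<in> (E \<inter> M \<times> M)\<^sup>* `` {t}"
  shows "(c, d) \<in> (E \<inter> (E \<inter> M \<times> M)\<^sup>* `` {t} \<times> (E \<inter> M \<times> M)\<^sup>* `` {t})\<^sup>*"
proof -
  let ?C = "(E \<inter> M \<times> M)\<^sup>* `` {t}"
  have *: "(t, x) \<in> (E \<inter> ?C \<times> ?C)\<^sup>*" if "(t, x) \<in> (E \<inter> M \<times> M)\<^sup>*" for x
    using that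
  proof induction
    case (step y z)
    then have "y \<in> ?C" "z \<in> ?C" "(y, z) \<in> E" by (auto intro: rtrancl_into_rtrancl)
    with step.IH show ?case by (auto intro: rtrancl_into_rtrancl)
  qed simp
  have "sym ((E \<inter> ?C \<times> ?C)\<^sup>*)" using assms(1) by (intro sym_rtrancl) (auto simp: sym_def)
  moreover have "(t, c) \<in> (E \<inter> ?C \<times> ?C)\<^sup>*" "(t, d) \<in> (E \<inter> ?C \<times> ?C)\<^sup>*"
    using assms(2,3) * by auto
  ultimately show ?thesis by (meson rtrancl_trans symD)
qed

section \<open>Simplicial vertices of chordal graphs\<close>

text \<open>The same notion as a chordless cycle of length at least 4, but for a bare edge relation: it is
  applied to the lines of a chain graph, whose arrows should not count as steps.\<close>

definition hole :: "('a \<times> 'a) set \<Rightarrow> 'a list \<Rightarrow> bool" where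
  "hole E vs \<longleftrightarrow> 4 \<le> length vs \<and> distinct vs
     \<and> (\<forall>i<length vs. (vs ! i, vs ! (Suc i mod length vs)) \<in> E)
     \<and> (\<forall>i<length vs. \<forall>j<length vs. (vs ! i, vs ! j) \<in> E
          \<longrightarrow> j = Suc i mod length vs \<or> i = Suc j mod length vs)"

lemma hole_from_path:
  assumes "sym E" "irrefl E" "2 \<le> n" "inj_on f {..n}" "\<And>i. i < n \<Longrightarrow> (f i, f (Suc i)) \<in> E"
    and chord: "\<And>i j. i \<le> n \<Longrightarrow> j \<le> n \<Longrightarrow> (f i, f j) \<in> E \<Longrightarrow> j = Suc i \<or> i = Suc j"
    and "(x, f 0) \<in> E" "(x, f n) \<in> E" "\<And>i. i \<le> n \<Longrightarrow> x \<noteq> f i"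
    and apex: "\<And>i. 0 < i \<Longrightarrow> i < n \<Longrightarrow> (x, f i) \<notin> E"
  shows "hole E (x # map f [0..<Suc n])"
proof -
  let ?vs = "x # map f [0..<Suc n]"
  have len: "length ?vs = Suc (Suc n)" by simp
  have nth: "?vs ! i = (case i of 0 \<Rightarrow> x | Suc j \<Rightarrow> f j)" if "i \<le> Suc n" for i
    using that by (cases i) (auto simp del: upt_Suc)
  have md: "Suc i mod Suc (Suc n) = (if i = Suc n then 0 else Suc i)" if "i \<le> Suc n" for i
    using that by (auto simp: mod_Suc)
  have dist: "distinct ?vs"
    using assms(4,9)
    by (auto simp: distinct_map atLeast0LessThan lessThan_Suc_atMost simp del: upt_Suc)
  have edge: "(?vs ! i, ?vs ! (Suc i mod length ?vs)) \<in> E" if "i < length ?vs" for i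
  proof -
    from that consider "i = 0" | "i = Suc n" | j where "i = Suc j" "j < n"
      unfolding len by (cases i) (auto simp: less_Suc_eq)
    then show ?thesis
    proof cases
      case 3 then show ?thesis using assms(5) unfolding len by (subst md) (auto simp del: upt_Suc)
    qed (use assms(1,7,8) in \<open>unfold len, subst md, auto simp del: upt_Suc dest: symD\<close>)
  qed
  have "j = Suc i mod length ?vs \<or> i = Suc j mod length ?vs"
    if "i < length ?vs" "j < length ?vs" "(?vs ! i, ?vs ! j) \<in> E" for i j
  proof -
    have x: "k = 0 \<or> k = n" if "k \<le> n" "(x, f k) \<in> E" for k
      using that apex[of k] by linarith
    have E: "(f k, x) \<in> E \<longleftrightarrow> (x, f k) \<in> E" for k using assms(1) by (auto dest: symD)
    have irr: "(x, x) \<notin> E" using assms(2) by (auto dest: irreflD)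
    have le: "i \<le> Suc n" "j \<le> Suc n" using that(1,2) by auto
    show ?thesis unfolding len md[OF le(1)] md[OF le(2)]
      using that(3) le nth[OF le(1)] nth[OF le(2)] irr
        x[of "i - 1"] x[of "j - 1"] chord[of "i - 1" "j - 1"]
      by (cases i; cases j) (auto simp: E)
  qed
  with dist edge assms(3) show ?thesis unfolding hole_def by auto
qed

text \<open>A form of Dirac's theorem that can be proved by induction on the vertex set. If the graph is not
  complete, there is a vertex \<open>x\<close> with a non-neighbour such that \<open>L\<close> lies in the closed neighbourhood
  of \<open>x\<close>: a vertex of \<open>L\<close>, or, if these are all adjacent to everything, any vertex with a
  non-neighbour. Let \<open>C\<close> be a component of the set of non-neighbours of \<open>x\<close>. Its boundary \<open>B\<close> is a
  clique of neighbours of \<open>x\<close>, since otherwise a path through \<open>C\<close> and \<open>x\<close> form a hole. By induction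
  \<open>C \<union> B\<close> has a simplicial vertex outside \<open>B\<close>, that is, in \<open>C\<close>, and all neighbours of this vertex are
  in \<open>C \<union> B\<close>.\<close>

lemma simplicial_vertex_outside_clique:
  assumes "finite V" "sym E" "irrefl E" "\<nexists>vs. hole E vs" "L \<subset> V"
    and "\<And>x y. x \<in> L \<Longrightarrow> y \<in> L \<Longrightarrow> x \<noteq> y \<Longrightarrow> (x, y) \<in> E"
  shows "\<exists>v\<in>V - L. \<forall>x\<in>V. \<forall>y\<in>V. (v, x) \<in> E \<longrightarrow> (v, y) \<in> E \<longrightarrow> x \<noteq> y \<longrightarrow> (x, y) \<in> E"
  using assms(1,5,6)
proof (induction V arbitrary: L rule: finite_psubset_induct)
  case (psubset V)
  show ?case
  proof (cases "\<forall>x\<in>V. \<forall>y\<in>V. x \<noteq> y \<longrightarrow> (x, y) \<in> E")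
    case True
    then show ?thesis using psubset.prems(1) by blast
  next
    case False
    obtain x z where xz: "x \<in> V" "z \<in> V" "x \<noteq> z" "(x, z) \<notin> E"
      and Lx: "\<And>l. l \<in> L \<Longrightarrow> l = x \<or> (x, l) \<in> E"
    proof (cases "\<exists>x\<in>L. \<exists>z\<in>V. x \<noteq> z \<and> (x, z) \<notin> E")
      case True
      then show thesis using psubset.prems that by blast
    next
      case no: False
      from False obtain x z where "x \<in> V" "z \<in> V" "x \<noteq> z" "(x, z) \<notin> E" by blast
      with no show thesis using that[of x z] \<open>sym E\<close> by (metis symD)
    qed
    define M where "M = {y \<in> V. y \<noteq> x \<and> (x, y) \<notin> E}"
    define C where "C = (E \<inter> M \<times> M)\<^sup>* `` {z}"
    define B where "B = {y \<in> V - C. \<exists>c\<in>C. (c, y) \<in> E}"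
    have zM: "z \<in> M" using xz by (auto simp: M_def)
    have CM: "C \<subseteq> M"
    proof
      fix y assume "y \<in> C"
      then have "(z, y) \<in> (E \<inter> M \<times> M)\<^sup>*" by (simp add: C_def)
      then show "y \<in> M" using zM by (cases rule: rtranclE) auto
    qed
    have zC: "z \<in> C" by (simp add: C_def)
    have Bx: "(x, y) \<in> E" if yB: "y \<in> B" for y
    proof (rule ccontr)
      assume n: "(x, y) \<notin> E"
      obtain c where c: "c \<in> C" "(c, y) \<in> E" "y \<in> V" "y \<notin> C" using yB by (auto simp: B_def)
      have "y \<noteq> x" using c CM \<open>sym E\<close> by (auto simp: M_def dest: symD)
      with n c CM have "(c, y) \<in> E \<inter> M \<times> M" by (auto simp: M_def)
      with c(1) have "y \<in> C" by (auto simp: C_def intro: rtrancl_into_rtrancl)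
      with c show False by simp
    qed
    have Bclique: "(y, y') \<in> E" if yB: "y \<in> B" "y' \<in> B" "y \<noteq> y'" for y y'
    proof (rule ccontr)
      assume n: "(y, y') \<notin> E"
      obtain c where c: "c \<in> C" "(c, y) \<in> E" using yB by (auto simp: B_def)
      obtain d where d: "d \<in> C" "(d, y') \<in> E" using yB by (auto simp: B_def)
      have conn: "(a, b) \<in> (E \<inter> C \<times> C)\<^sup>*" if "a \<in> C" "b \<in> C" for a b
        using reachable_set_connected[OF \<open>sym E\<close>] that unfolding C_def by blast
      obtain f n where f: "2 \<le> n" "f 0 = y" "f n = y'" "inj_on f {..n}"
        "\<And>i. 0 < i \<Longrightarrow> i < n \<Longrightarrow> f i \<in> C" "\<And>i. i < n \<Longrightarrow> (f i, f (Suc i)) \<in> E"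
        "\<And>i j. i \<le> n \<Longrightarrow> j \<le> n \<Longrightarrow> (f i, f j) \<in> E \<Longrightarrow> j = Suc i \<or> i = Suc j"
        using shortest_path_through[OF \<open>sym E\<close> \<open>irrefl E\<close> conn c d yB(3) n] by metis
      have int: "(x, f i) \<notin> E" "x \<noteq> f i" if "0 < i" "i < n" for i
        using f(5)[OF that] CM by (auto simp: M_def)
      have "x \<noteq> f i" if "i \<le> n" for i
      proof -
        have "i = 0 \<or> i = n \<or> (0 < i \<and> i < n)" using that by linarith
        then show ?thesis using Bx[OF yB(1)] Bx[OF yB(2)] f(2,3) \<open>irrefl E\<close> int(2)
          by (auto dest: irreflD)
      qed
      then have "hole E (x # map f [0..<Suc n])"
        using hole_from_path[OF assms(2,3) f(1,4,6,7)] Bx yB f(2,3) int(1) by auto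
      then show False using assms(4) by blast
    qed
    have "x \<notin> C \<union> B" using CM Bx \<open>irrefl E\<close> by (auto simp: M_def dest: irreflD)
    moreover have "C \<subseteq> V" using CM by (auto simp: M_def)
    ultimately have W: "C \<union> B \<subset> V" using xz(1) by (auto simp: B_def)
    have "B \<subset> C \<union> B" using zC by (auto simp: B_def)
    from psubset.IH[OF W this Bclique] obtain v where v: "v \<in> C \<union> B - B"
      and simp: "\<And>a b. a \<in> C \<union> B \<Longrightarrow> b \<in> C \<union> B \<Longrightarrow> (v, a) \<in> E \<Longrightarrow> (v, b) \<in> E \<Longrightarrow> a \<noteq> b \<Longrightarrow> (a, b) \<in> E"
      by blast
    have vC: "v \<in> C" using v by blast
    then have "v \<in> V - L" using CM Lx by (auto simp: M_def)
    moreover have "a \<in> C \<union> B" if "a \<in> V" "(v, a) \<in> E" for a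
      using that vC by (auto simp: B_def)
    ultimately show ?thesis using simp by blast
  qed
qed

section \<open>Chain graphs and triplexes\<close>

text \<open>Triplexes as a predicate on ordered triples, which covers immoralities and both flags
  uniformly: the edges at \<open>b\<close> do not leave \<open>b\<close>, and at least one of them is an arrow.\<close>

definition triplex :: "'a mixed_graph \<Rightarrow> 'a \<Rightarrow> 'a \<Rightarrow> 'a \<Rightarrow> bool" where
  "triplex G a b c \<longleftrightarrow> a \<noteq> c \<and> \<not> adj G a c \<and> step G a b \<and> step G c b
     \<and> ((a, b) \<in> arrows G \<or> (c, b) \<in> arrows G)"

lemma adj_sym: "mixed_graph G \<Longrightarrow> adj G a b \<longleftrightarrow> adj G b a"
  by (auto simp: adj_def mixed_graph_def dest: symD)

lemma lines_sym: "mixed_graph G \<Longrightarrow> (a, b) \<in> lines G \<longleftrightarrow> (b, a) \<in> lines G"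
  by (auto simp: mixed_graph_def dest: symD)

lemma arrows_asym: "mixed_graph G \<Longrightarrow> (a, b) \<in> arrows G \<Longrightarrow> (b, a) \<notin> arrows G"
  by (auto simp: mixed_graph_def dest: asymD)

lemma arrows_not_lines: "mixed_graph G \<Longrightarrow> (a, b) \<in> arrows G \<Longrightarrow> (a, b) \<notin> lines G \<and> (b, a) \<notin> lines G"
  by (auto simp: mixed_graph_def dest: symD)

lemma not_adj_self: "mixed_graph G \<Longrightarrow> \<not> adj G a a"
  by (auto simp: mixed_graph_def adj_def dest: asymD irreflD)

lemma triplex_sym: "mixed_graph G \<Longrightarrow> triplex G a b c \<longleftrightarrow> triplex G c b a"
  by (auto simp: triplex_def adj_sym)

lemma triplexes_eq:
  assumes "mixed_graph G"
  shows "triplexes G = {({a, c}, b) | a b c. triplex G a b c}"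
proof -
  have "immoralities G \<subseteq> {({a, c}, b) | a b c. triplex G a b c}"
    by (auto simp: immoralities_def triplex_def step_def)
  moreover have "{({a, c}, b) | a b c. a \<noteq> c \<and> \<not> adj G a c \<and> (a, b) \<in> arrows G \<and> (b, c) \<in> lines G}
     \<subseteq> {({a, c}, b) | a b c. triplex G a b c}"
    using lines_sym[OF assms] by (auto simp: triplex_def step_def)
  moreover have "({a, c}, b) \<in> triplexes G" if t: "triplex G a b c" for a b c
  proof -
    consider "(a, b) \<in> arrows G" "(c, b) \<in> arrows G" | "(a, b) \<in> arrows G" "(b, c) \<in> lines G"
      | "(c, b) \<in> arrows G" "(b, a) \<in> lines G"
      using t lines_sym[OF assms] by (auto simp: triplex_def step_def)
    then show ?thesis
    proof cases
      case 3
      moreover have "c \<noteq> a" "\<not> adj G c a" using t adj_sym[OF assms] by (auto simp: triplex_def)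
      ultimately have "({c, a}, b) \<in> triplexes G" unfolding triplexes_def by blast
      then show ?thesis by (simp add: insert_commute)
    qed (use t in \<open>auto simp: triplexes_def immoralities_def triplex_def\<close>)
  qed
  then have "{({a, c}, b) | a b c. triplex G a b c} \<subseteq> triplexes G" by auto
  ultimately show ?thesis unfolding triplexes_def by (intro subset_antisym Un_least)
qed

lemma mem_triplexes_iff:
  assumes "mixed_graph G"
  shows "({a, c}, b) \<in> triplexes G \<longleftrightarrow> triplex G a b c"
  unfolding triplexes_eq[OF assms] using triplex_sym[OF assms] by (auto simp: doubleton_eq_iff)

lemma skeleton_eq_iff:
  "skeleton G = skeleton H \<longleftrightarrow> verts G = verts H \<and> (\<forall>a b. adj G a b \<longleftrightarrow> adj H a b)"
  by (auto simp: skeleton_def set_eq_iff)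

lemma cyclic_walk_returns:
  assumes "\<And>i. i < length vs \<Longrightarrow> (vs ! i, vs ! (Suc i mod length vs)) \<in> R" "i < length vs"
  shows "(vs ! (Suc i mod length vs), vs ! i) \<in> R\<^sup>*"
proof -
  let ?n = "length vs"
  have "(vs ! (Suc i mod ?n), vs ! ((Suc i + k) mod ?n)) \<in> R\<^sup>*" for k
  proof (induction k)
    case (Suc k)
    have "(vs ! ((Suc i + k) mod ?n), vs ! (Suc ((Suc i + k) mod ?n) mod ?n)) \<in> R"
      using assms by (intro assms(1)) (auto intro: mod_less_divisor)
    with Suc show ?case by (auto simp: mod_Suc_eq intro: rtrancl_into_rtrancl)
  qed simp
  from this[of "?n - 1"] have "(vs ! (Suc i mod ?n), vs ! ((i + ?n) mod ?n)) \<in> R\<^sup>*"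
    using assms(2) by (metis Suc_diff_1 add_Suc_shift bot_nat_0.not_eq_extremum not_less_zero)
  then show ?thesis using assms(2) by simp
qed

text \<open>Any walk back from the head to the tail of an arrow can be shortened to a path, which must have
  at least two edges because the two vertices are joined by only one edge; hence cycles with
  repeated vertices are excluded as well, and reachability can replace lists of vertices.\<close>

lemma chain_graph_iff:
  "chain_graph G \<longleftrightarrow> mixed_graph G \<and> (\<forall>a b. (a, b) \<in> arrows G \<longrightarrow> (b, a) \<notin> (arrows G \<union> lines G)\<^sup>*)"
proof (cases "mixed_graph G")
  case True
  let ?R = "arrows G \<union> lines G"
  have "(b, a) \<in> ?R\<^sup>*" "(a, b) \<in> arrows G"
    if "semi_directed_cycle G vs" "i < length vs" "(vs ! i, vs ! (Suc i mod length vs)) \<in> arrows G"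
      "a = vs ! i" "b = vs ! (Suc i mod length vs)" for a b vs i
    using that cyclic_walk_returns[of vs ?R i]
    by (auto simp: semi_directed_cycle_def is_cycle_def step_def)
  moreover have "\<exists>vs. semi_directed_cycle G vs" if ab: "(a, b) \<in> arrows G" "(b, a) \<in> ?R\<^sup>*" for a b
  proof -
    obtain f n where f: "f 0 = b" "f n = a" "\<And>i. i < n \<Longrightarrow> (f i, f (Suc i)) \<in> ?R" "inj_on f {..n}"
      using shortest_path[OF ab(2)] by metis
    have n2: "2 \<le> n"
    proof (rule ccontr)
      assume "\<not> 2 \<le> n"
      then have "n = 0 \<or> n = 1" by linarith
      then show False
        using f(1-3) ab(1) arrows_asym[OF True] arrows_not_lines[OF True] by fastforce
    qed
    define vs where "vs = map f [0..<Suc n]"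
    have len: "length vs = Suc n" by (simp add: vs_def)
    have nth: "vs ! i = f i" if "i \<le> n" for i
      using that by (auto simp: vs_def simp del: upt_Suc)
    have md: "Suc i mod Suc n = (if i = n then 0 else Suc i)" if "i \<le> n" for i
      using that by (auto simp: mod_Suc)
    have "step G (vs ! i) (vs ! (Suc i mod length vs))" if "i < length vs" for i
    proof -
      have "i \<le> n" using that len by simp
      with f ab(1) show ?thesis unfolding len by (subst md) (auto simp: nth step_def)
    qed
    moreover have "distinct vs" using f(4)
      by (simp add: vs_def distinct_map atLeast0LessThan lessThan_Suc_atMost del: upt_Suc)
    ultimately have "is_cycle G vs" using n2 len by (simp add: is_cycle_def)
    moreover have "n < length vs" "(vs ! n, vs ! (Suc n mod length vs)) \<in> arrows G"
      using ab(1) f(1,2) len by (auto simp: nth)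
    ultimately show ?thesis unfolding semi_directed_cycle_def by blast
  qed
  ultimately show ?thesis unfolding chain_graph_def using True
    by (metis semi_directed_cycle_def)
qed (simp add: chain_graph_def)

lemma chain_graphD:
  "chain_graph G \<Longrightarrow> (a, b) \<in> arrows G \<Longrightarrow> (b, a) \<notin> (arrows G \<union> lines G)\<^sup>*"
  by (simp add: chain_graph_iff)

lemma chain_graph_mixed: "chain_graph G \<Longrightarrow> mixed_graph G"
  by (simp add: chain_graph_def)

lemma ADG_iff: "ADG G \<longleftrightarrow> chain_graph G \<and> lines G = {}"
proof -
  have "semi_directed_cycle G vs \<longleftrightarrow> is_cycle G vs" if "lines G = {}" for vs
    using that unfolding semi_directed_cycle_def is_cycle_def step_def
    by (metis empty_iff less_le_trans zero_less_numeral)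
  then show ?thesis unfolding ADG_def chain_graph_def by blast
qed

lemma ADG_immoralities: "ADG D \<Longrightarrow> immoralities D = triplexes D"
  by (auto simp: ADG_def triplexes_def)


section \<open>Consequences of Markov equivalence\<close>

lemma amp_class_iff:
  assumes "chain_graph G"
  shows "H \<in> amp_class G \<longleftrightarrow> chain_graph H \<and> verts H = verts G
    \<and> (\<forall>a b. adj H a b \<longleftrightarrow> adj G a b) \<and> (\<forall>a b c. triplex H a b c \<longleftrightarrow> triplex G a b c)"
proof -
  have "triplexes H = triplexes G \<longleftrightarrow> (\<forall>a b c. triplex H a b c \<longleftrightarrow> triplex G a b c)" if "chain_graph H"
  proof
    assume "triplexes H = triplexes G"
    then show "\<forall>a b c. triplex H a b c \<longleftrightarrow> triplex G a b c"
      using mem_triplexes_iff[OF chain_graph_mixed] that assms by metis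
  next
    assume "\<forall>a b c. triplex H a b c \<longleftrightarrow> triplex G a b c"
    then show "triplexes H = triplexes G"
      by (simp add: triplexes_eq chain_graph_mixed that assms)
  qed
  then show ?thesis unfolding amp_class_def skeleton_eq_iff by blast
qed

lemma amp_class_refl: "chain_graph G \<Longrightarrow> G \<in> amp_class G"
  by (simp add: amp_class_def)

lemma amp_class_eq: "H \<in> amp_class G \<Longrightarrow> amp_class H = amp_class G"
  by (simp add: amp_class_def)

lemma adg_class_eq: "ADG D \<Longrightarrow> adg_class D = {H \<in> amp_class D. ADG H}"
  unfolding adg_class_def amp_class_def by (auto simp: ADG_immoralities ADG_iff)

text \<open>The basic propagation of orientations: at an unshielded triple that is not a triplex, an arrow
  into the middle vertex has to leave it again.\<close>

lemma nontriplex_arrow_step: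
  assumes "\<not> triplex H a b c" "a \<noteq> c" "\<not> adj H a c" "adj H b c" "(a, b) \<in> arrows H" "mixed_graph H"
  shows "(b, c) \<in> arrows H"
  using assms lines_sym[OF assms(6)] by (auto simp: triplex_def adj_def step_def)

lemma triplex_with_line:
  assumes "triplex H a b c" "(b, c) \<in> lines H" "mixed_graph H"
  shows "(a, b) \<in> arrows H"
  using assms arrows_not_lines[OF assms(3)] by (auto simp: triplex_def)

lemma triplex_no_arrow_out:
  assumes "triplex H a b c" "mixed_graph H"
  shows "(b, a) \<notin> arrows H" "(b, c) \<notin> arrows H"
  using assms arrows_not_lines[OF assms(2)] arrows_asym[OF assms(2)]
  by (auto simp: triplex_def step_def)

lemma parent_propagates:
  assumes "chain_graph H" "(a, x) \<in> arrows H" "(x, y) \<in> lines H" "adj H a y"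
  shows "(a, y) \<in> arrows H"
proof (rule ccontr)
  let ?R = "arrows H \<union> lines H"
  assume "(a, y) \<notin> arrows H"
  then have "(y, a) \<in> ?R" using assms(4) lines_sym[OF chain_graph_mixed[OF assms(1)]]
    by (auto simp: adj_def)
  moreover have "(x, y) \<in> ?R" using assms(3) by simp
  ultimately have "(x, a) \<in> ?R\<^sup>*" by (meson r_into_rtrancl rtrancl_trans)
  then show False using chain_graphD[OF assms(1,2)] by simp
qed

lemma parent_outside_component:
  assumes "chain_graph H" "(a, c) \<in> arrows H" "(c, l) \<in> (lines H)\<^sup>*"
  shows "a \<noteq> l" "\<not> adj H a l \<or> (a, l) \<in> arrows H"
proof -
  let ?R = "arrows H \<union> lines H"
  have cl: "(c, l) \<in> ?R\<^sup>*" using assms(3) rtrancl_mono[of "lines H" ?R] by auto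
  then show "a \<noteq> l" using chain_graphD[OF assms(1,2)] by auto
  have "(l, a) \<notin> ?R" using cl chain_graphD[OF assms(1,2)] by (meson rtrancl.rtrancl_into_rtrancl)
  then show "\<not> adj H a l \<or> (a, l) \<in> arrows H"
    using lines_sym[OF chain_graph_mixed[OF assms(1)]] by (auto simp: adj_def)
qed

lemma component_adj_line:
  assumes "chain_graph H" "(x, y) \<in> (lines H)\<^sup>*" "adj H x y"
  shows "(x, y) \<in> lines H"
proof -
  have m: "mixed_graph H" using assms(1) by (rule chain_graph_mixed)
  have yx: "(y, x) \<in> (lines H)\<^sup>*"
    using assms(2) m by (auto simp: mixed_graph_def dest: sym_rtrancl symD)
  have "(a, b) \<notin> arrows H" if "(b, a) \<in> (lines H)\<^sup>*" for a b
    using that chain_graphD[OF assms(1)] rtrancl_mono[of "lines H" "arrows H \<union> lines H"] by auto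
  then show ?thesis using assms(2,3) yx by (auto simp: adj_def)
qed

text \<open>In another member \<open>H'\<close>, an arrow along the path is propagated to the last edge and an arrow
  against it to the first edge. The two hypotheses on these edges say that this is impossible; for a
  biflag they come from the triplexes at the second and at the last but one vertex.\<close>

lemma lines_of_path_rigid:
  assumes H: "chain_graph H" and H': "H' \<in> amp_class H"
    and p: "chordless_undirected_path H cs" and len: "length cs = Suc (Suc m)"
    and first: "(cs ! 1, cs ! 0) \<notin> arrows H'" and last: "(cs ! m, cs ! Suc m) \<notin> arrows H'"
    and i: "i \<le> m"
  shows "(cs ! i, cs ! Suc i) \<in> lines H'"
proof -
  have c: "chain_graph H'" and ad: "\<And>a b. adj H' a b \<longleftrightarrow> adj H a b"
    and tr: "\<And>a b c. triplex H' a b c \<longleftrightarrow> triplex H a b c"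
    using H' by (auto simp: amp_class_iff[OF H])
  note m = chain_graph_mixed[OF c] and mH = chain_graph_mixed[OF H]
  have line: "(cs ! j, cs ! Suc j) \<in> lines H" if "j \<le> m" for j
    using p that len by (auto simp: chordless_undirected_path_def)
  have adj: "adj H' (cs ! j) (cs ! Suc j)" if "j \<le> m" for j
    using line[OF that] unfolding ad by (simp add: adj_def)
  have far: "cs ! j \<noteq> cs ! Suc (Suc j)" "\<not> adj H' (cs ! j) (cs ! Suc (Suc j))" if "Suc j \<le> m" for j
  proof -
    have lt: "j < length cs" "Suc (Suc j) < length cs" using that len by simp_all
    have "distinct cs" using p by (simp add: chordless_undirected_path_def)
    then show "cs ! j \<noteq> cs ! Suc (Suc j)" using nth_eq_iff_index_eq[OF _ lt] by auto
    have "adj H (cs ! j) (cs ! Suc (Suc j)) \<Longrightarrow> Suc (Suc j) = Suc j \<or> j = Suc (Suc (Suc j))"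
      using p lt unfolding chordless_undirected_path_def by blast
    then show "\<not> adj H' (cs ! j) (cs ! Suc (Suc j))" unfolding ad by auto
  qed
  have nt: "\<not> triplex H' (cs ! j) (cs ! Suc j) (cs ! Suc (Suc j))" if "Suc j \<le> m" for j
    using line[of j] line[of "Suc j"] that arrows_not_lines[OF mH] unfolding tr by (auto simp: triplex_def)
  have up: "(cs ! m, cs ! Suc m) \<in> arrows H'"
    if "j \<le> m" "(cs ! j, cs ! Suc j) \<in> arrows H'" for j
    using that
  proof (induction j rule: inc_induct)
    case (step j)
    then show ?case using nontriplex_arrow_step[OF nt far adj _ m] by simp
  qed
  have down: "(cs ! 1, cs ! 0) \<in> arrows H'" if "j \<le> m" "(cs ! Suc j, cs ! j) \<in> arrows H'" for j
    using that
  proof (induction j)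
    case (Suc j)
    then have "(cs ! Suc j, cs ! j) \<in> arrows H'"
      using nontriplex_arrow_step[of H' "cs ! Suc (Suc j)" "cs ! Suc j" "cs ! j"] nt[of j] far[of j]
        adj[of j] m by (auto simp: triplex_sym[OF m] adj_sym[OF m])
    with Suc show ?case by simp
  qed simp
  show ?thesis using adj[OF i] up[OF i] down[OF i] first last by (auto simp: adj_def)
qed

lemma chordless_path_invariant:
  assumes "chain_graph H" "H' \<in> amp_class H" "chordless_undirected_path H cs"
    and "\<And>i. Suc i < length cs \<Longrightarrow> (cs ! i, cs ! Suc i) \<in> lines H'"
  shows "chordless_undirected_path H' cs"
  using assms unfolding chordless_undirected_path_def amp_class_iff[OF assms(1)] by simp

text \<open>The triplexes at the two ends make the path rigid. They then force the arrows from \<open>a\<close> to the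
  outermost interior vertices, and the other arrows from \<open>a\<close> follow because a semi-directed triangle
  is impossible.\<close>

lemma biflag1_invariant:
  assumes H: "chain_graph H" and H': "H' \<in> amp_class H" and b: "biflag1 H a cs"
  shows "biflag1 H' a cs"
proof -
  have c: "chain_graph H'" and ad: "\<And>a b. adj H' a b \<longleftrightarrow> adj H a b"
    and tr: "\<And>a b c. triplex H' a b c \<longleftrightarrow> triplex H a b c"
    using H' by (auto simp: amp_class_iff[OF H])
  note m = chain_graph_mixed[OF c] and mH = chain_graph_mixed[OF H]
  obtain k where k: "length cs = Suc (Suc (Suc k))"
    using b by (auto simp: biflag1_def numeral_3_eq_3 Suc_le_eq less_iff_Suc_add)
  have p: "chordless_undirected_path H cs" using b by (simp add: biflag1_def)
  have arr: "(a, cs ! i) \<in> arrows H" if "0 < i" "i < Suc (Suc k)" for i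
    using b that k by (simp add: biflag1_def)
  have line: "(cs ! i, cs ! Suc i) \<in> lines H" if "i < Suc (Suc k)" for i
    using p that k by (auto simp: chordless_undirected_path_def)
  have ends: "a \<notin> set cs" "\<not> adj H a (cs ! 0)" "\<not> adj H a (cs ! Suc (Suc k))"
    using b k by (auto simp: biflag1_def)
  then have ne: "a \<noteq> cs ! i" if "i < Suc (Suc (Suc k))" for i using that k nth_mem by metis
  have t1: "triplex H a (cs ! 1) (cs ! 0)"
    using ends ne[of 0] arr[of 1] line[of 0] lines_sym[OF mH] by (auto simp: triplex_def step_def)
  have t2: "triplex H a (cs ! Suc k) (cs ! Suc (Suc k))"
    using ends ne[of "Suc (Suc k)"] arr[of "Suc k"] line[of "Suc k"] lines_sym[OF mH]
    by (auto simp: triplex_def step_def)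
  have line': "(cs ! i, cs ! Suc i) \<in> lines H'" if "i \<le> Suc k" for i
    using lines_of_path_rigid[OF H H' p k] that t1 t2 triplex_no_arrow_out[OF _ m] by (simp add: tr)
  have a1: "(a, cs ! 1) \<in> arrows H'"
    using triplex_with_line[OF _ _ m] t1 line'[of 0] lines_sym[OF m] by (metis One_nat_def tr le0)
  have arr': "(a, cs ! Suc i) \<in> arrows H'" if "i \<le> k" for i
    using that
  proof (induction i)
    case (Suc i)
    have "adj H' a (cs ! Suc (Suc i))" using arr[of "Suc (Suc i)"] Suc.prems unfolding ad by (simp add: adj_def)
    then show ?case using parent_propagates[OF c] Suc line'[of "Suc i"] by simp
  qed (use a1 in simp)
  have "(a, cs ! i) \<in> arrows H'" if "0 < i \<and> i < length cs - 1" for i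
    using arr'[of "i - 1"] that k by (cases i) auto
  moreover have "chordless_undirected_path H' cs"
    using chordless_path_invariant[OF H H' p] line' k by simp
  ultimately show ?thesis using ends k by (simp add: biflag1_def ad)
qed

text \<open>As for the first type of biflag. The arrows from \<open>a\<close> are recovered starting at the end of the
  path, where \<open>a\<close> takes part in a triplex, those from \<open>b\<close> starting at its beginning.\<close>

lemma biflag2_invariant:
  assumes H: "chain_graph H" and H': "H' \<in> amp_class H" and bf: "biflag2 H a b cs"
  shows "biflag2 H' a b cs"
proof -
  have c: "chain_graph H'" and ad: "\<And>a b. adj H' a b \<longleftrightarrow> adj H a b"
    and tr: "\<And>a b c. triplex H' a b c \<longleftrightarrow> triplex H a b c"
    using H' by (auto simp: amp_class_iff[OF H])
  note m = chain_graph_mixed[OF c] and mH = chain_graph_mixed[OF H]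
  obtain k where k: "length cs = Suc (Suc k)"
    using bf by (auto simp: biflag2_def numeral_2_eq_2 Suc_le_eq less_iff_Suc_add)
  have p: "chordless_undirected_path H cs" using bf by (simp add: biflag2_def)
  have a: "(a, cs ! i) \<in> arrows H" if "i \<le> k" for i
    using bf that k by (simp add: biflag2_def)
  have b: "(b, cs ! Suc i) \<in> arrows H" if "i \<le> k" for i
    using bf that k by (simp add: biflag2_def)
  have line: "(cs ! i, cs ! Suc i) \<in> lines H" if "i \<le> k" for i
    using p that k by (auto simp: chordless_undirected_path_def)
  have ends: "a \<notin> set cs" "b \<notin> set cs" "a \<noteq> b" "\<not> adj H b (cs ! 0)" "\<not> adj H a (cs ! Suc k)"
    using bf k by (auto simp: biflag2_def)
  then have ne: "a \<noteq> cs ! i" "b \<noteq> cs ! i" if "i < Suc (Suc k)" for i using that k nth_mem by metis+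
  have t1: "triplex H b (cs ! 1) (cs ! 0)"
    using ends ne[of 0] b[of 0] line[of 0] lines_sym[OF mH] by (auto simp: triplex_def step_def)
  have t2: "triplex H a (cs ! k) (cs ! Suc k)"
    using ends ne[of "Suc k"] a[of k] line[of k] lines_sym[OF mH]
    by (auto simp: triplex_def step_def)
  have line': "(cs ! i, cs ! Suc i) \<in> lines H'" if "i \<le> k" for i
    using lines_of_path_rigid[OF H H' p k] that t1 t2 triplex_no_arrow_out[OF _ m] by (simp add: tr)
  have b1: "(b, cs ! 1) \<in> arrows H'"
    using triplex_with_line[OF _ _ m] t1 line'[of 0] lines_sym[OF m] by (metis One_nat_def tr le0)
  have ak: "(a, cs ! k) \<in> arrows H'"
    using triplex_with_line[OF _ _ m] t2 line'[of k] by (simp add: tr)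
  have b': "(b, cs ! Suc i) \<in> arrows H'" if "i \<le> k" for i
    using that
  proof (induction i)
    case (Suc i)
    have "adj H' b (cs ! Suc (Suc i))" using b[of "Suc i"] Suc.prems unfolding ad by (simp add: adj_def)
    then show ?case using parent_propagates[OF c] Suc line'[of "Suc i"] by simp
  qed (use b1 in simp)
  have a': "(a, cs ! i) \<in> arrows H'" if "i \<le> k" for i
    using that
  proof (induction i rule: inc_induct)
    case (step i)
    have "adj H' a (cs ! i)" using a[of i] step.hyps unfolding ad by (simp add: adj_def)
    moreover have "(cs ! Suc i, cs ! i) \<in> lines H'"
      using line'[of i] step.hyps lines_sym[OF m] by simp
    ultimately show ?case using parent_propagates[OF c] step.IH by blast
  qed (use ak in simp)
  have "(b, cs ! i) \<in> arrows H'" if "0 < i \<and> i < length cs" for i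
    using b'[of "i - 1"] that k by (cases i) auto
  moreover have "chordless_undirected_path H' cs"
    using chordless_path_invariant[OF H H' p] line' k by simp
  ultimately show ?thesis using a' ends k by (simp add: biflag2_def ad)
qed

lemma chordless_cycle_two_apart:
  assumes "4 \<le> length vs" "distinct vs" "j < length vs"
    and "\<And>i j. i < length vs \<Longrightarrow> j < length vs \<Longrightarrow> P (vs ! i) (vs ! j)
      \<Longrightarrow> j = Suc i mod length vs \<or> i = Suc j mod length vs"
  shows "vs ! j \<noteq> vs ! (Suc (Suc j) mod length vs)" "\<not> P (vs ! j) (vs ! (Suc (Suc j) mod length vs))"
proof -
  let ?n = "length vs"
  have lt: "Suc (Suc j) mod ?n < ?n" using assms(1) by (intro mod_less_divisor) linarith
  have idx: "Suc (Suc j) mod ?n \<noteq> j" "Suc (Suc j) mod ?n \<noteq> Suc j mod ?n"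
    "Suc (Suc (Suc j)) mod ?n \<noteq> j"
    using assms(1,3) by (auto simp: mod_Suc)
  show "vs ! j \<noteq> vs ! (Suc (Suc j) mod ?n)"
    using assms(2,3) lt idx(1) by (simp add: nth_eq_iff_index_eq)
  show "\<not> P (vs ! j) (vs ! (Suc (Suc j) mod ?n))"
    using assms(4)[OF assms(3) lt] idx by (auto simp: mod_Suc_eq)
qed

text \<open>An arrow in the direction of the cycle would be pushed all around it and close up to a directed
  cycle. So every edge is a line or points backwards, and a single backward arrow would make the
  reversed cycle semi-directed.\<close>

lemma triplex_free_cycle_undirected:
  assumes H: "chain_graph H"
    and adj: "\<And>j. j < length vs \<Longrightarrow> adj H (vs ! j) (vs ! (Suc j mod length vs))"
    and far: "\<And>j. j < length vs \<Longrightarrow> vs ! j \<noteq> vs ! (Suc (Suc j) mod length vs)"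
      "\<And>j. j < length vs \<Longrightarrow> \<not> adj H (vs ! j) (vs ! (Suc (Suc j) mod length vs))"
    and nt: "\<And>j. j < length vs \<Longrightarrow>
      \<not> triplex H (vs ! j) (vs ! (Suc j mod length vs)) (vs ! (Suc (Suc j) mod length vs))"
    and i: "i < length vs"
  shows "(vs ! i, vs ! (Suc i mod length vs)) \<in> lines H"
proof -
  let ?n = "length vs" and ?R = "arrows H \<union> lines H"
  note m = chain_graph_mixed[OF H]
  have lt: "j mod ?n < ?n" for j using i by (intro mod_less_divisor) linarith
  have push: "(vs ! (Suc j mod ?n), vs ! (Suc (Suc j) mod ?n)) \<in> arrows H"
    if j: "j < ?n" "(vs ! j, vs ! (Suc j mod ?n)) \<in> arrows H" for j
  proof -
    have "adj H (vs ! (Suc j mod ?n)) (vs ! (Suc (Suc j) mod ?n))"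
      using adj[OF lt[of "Suc j"]] by (simp add: mod_Suc_eq)
    then show ?thesis using nontriplex_arrow_step[OF nt far _ _ m] j by blast
  qed
  have no: "(vs ! j, vs ! (Suc j mod ?n)) \<notin> arrows H" if j: "j < ?n" for j
  proof
    assume a: "(vs ! j, vs ! (Suc j mod ?n)) \<in> arrows H"
    have shift: "(vs ! ((j + k) mod ?n), vs ! (Suc (j + k) mod ?n)) \<in> arrows H" for k
    proof (induction k)
      case (Suc k)
      then show ?case using push[OF lt[of "j + k"]] by (simp add: mod_Suc_eq mod_Suc_Suc_eq)
    qed (use a j in simp)
    have "(vs ! k, vs ! (Suc k mod ?n)) \<in> arrows H" if "k < ?n" for k
    proof -
      have "j + (?n - j + k) = ?n + k" using j by simp
      with shift[of "?n - j + k"] that show ?thesis by (metis mod_Suc_eq mod_add_self1 mod_less)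
    qed
    then have "(vs ! (Suc j mod ?n), vs ! j) \<in> (arrows H)\<^sup>*"
      using cyclic_walk_returns[of vs "arrows H" j] j by blast
    then show False using a chain_graphD[OF H] rtrancl_mono[of "arrows H" ?R] by blast
  qed
  have "(vs ! j, vs ! (Suc j mod ?n)) \<in> ?R\<inverse>" if "j < ?n" for j
    using adj[OF that] no[OF that] lines_sym[OF m] by (auto simp: adj_def)
  then have "(vs ! i, vs ! (Suc i mod ?n)) \<in> ?R\<^sup>*"
    using cyclic_walk_returns[of vs "?R\<inverse>" i] i unfolding rtrancl_converse by blast
  then have "(vs ! (Suc i mod ?n), vs ! i) \<notin> arrows H" using chain_graphD[OF H] by blast
  then show ?thesis using adj[OF i] no[OF i] by (auto simp: adj_def)
qed

lemma hole_line_adj: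
  assumes H: "chain_graph H" and h: "hole (lines H) vs" and "i < length vs" "j < length vs"
    and "adj H (vs ! i) (vs ! j)"
  shows "j = Suc i mod length vs \<or> i = Suc j mod length vs"
proof -
  let ?n = "length vs"
  have walk: "(vs ! 0, vs ! k) \<in> (lines H)\<^sup>*" if "k < ?n" for k
    using that
  proof (induction k)
    case (Suc k)
    then have "(vs ! k, vs ! Suc k) \<in> lines H" using h unfolding hole_def by (metis Suc_lessD mod_less)
    with Suc show ?case by (auto intro: rtrancl_into_rtrancl)
  qed simp
  have "sym ((lines H)\<^sup>*)"
    using chain_graph_mixed[OF H] by (auto simp: mixed_graph_def intro: sym_rtrancl)
  then have "(vs ! i, vs ! j) \<in> (lines H)\<^sup>*" using walk assms(3,4) by (meson rtrancl_trans symD)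
  then have "(vs ! i, vs ! j) \<in> lines H" using component_adj_line[OF H] assms(5) by blast
  then show ?thesis using h assms(3,4) by (auto simp: hole_def)
qed

lemma hole_lines_invariant:
  assumes H: "chain_graph H" and H': "H' \<in> amp_class H" and h: "hole (lines H) vs"
    and i: "i < length vs"
  shows "(vs ! i, vs ! (Suc i mod length vs)) \<in> lines H'"
proof -
  let ?n = "length vs"
  have c: "chain_graph H'" and ad: "\<And>a b. adj H' a b \<longleftrightarrow> adj H a b"
    and tr: "\<And>a b c. triplex H' a b c \<longleftrightarrow> triplex H a b c"
    using H' by (auto simp: amp_class_iff[OF H])
  have n4: "4 \<le> ?n" and d: "distinct vs" using h by (auto simp: hole_def)
  have line: "(vs ! j, vs ! (Suc j mod ?n)) \<in> lines H" if "j < ?n" for j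
    using h that by (simp add: hole_def)
  note apart = chordless_cycle_two_apart[OF n4 d _ hole_line_adj[OF H h]]
  show ?thesis
  proof (rule triplex_free_cycle_undirected[OF c _ _ _ _ i])
    fix j assume j: "j < ?n"
    show "adj H' (vs ! j) (vs ! (Suc j mod ?n))" using line[OF j] unfolding ad by (simp add: adj_def)
    show "vs ! j \<noteq> vs ! (Suc (Suc j) mod ?n)" "\<not> adj H' (vs ! j) (vs ! (Suc (Suc j) mod ?n))"
      using apart[OF j] by (simp_all add: ad)
    have "Suc j mod ?n < ?n" using j by (intro mod_less_divisor) linarith
    then have "(vs ! (Suc j mod ?n), vs ! (Suc (Suc j) mod ?n)) \<in> lines H"
      using line by (metis mod_Suc_eq)
    then show "\<not> triplex H' (vs ! j) (vs ! (Suc j mod ?n)) (vs ! (Suc (Suc j) mod ?n))"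
      using line[OF j] arrows_not_lines[OF chain_graph_mixed[OF H]]
      unfolding tr by (auto simp: triplex_def)
  qed
qed

section \<open>Turning a chain graph into an acyclic directed graph\<close>

text \<open>A closed walk in \<open>D'\<close> that uses an arrow of \<open>H\<close> contradicts adicyclicity of \<open>H\<close>; all others run
  in \<open>D\<close>. A triplex of \<open>H\<close> is an immorality of \<open>D\<close>, so its lines are oriented towards the middle
  vertex; conversely two lines of \<open>H\<close> from nonadjacent vertices would meet head to head in a
  triplex of \<open>D\<close>, hence of \<open>H\<close>, which needs an arrow.\<close>

lemma orient_lines_like_ADG:
  assumes H: "chain_graph H" and D: "D \<in> amp_class H" "ADG D"
  defines "D' \<equiv> \<lparr>verts = verts H, arrows = arrows H \<union> (lines H \<inter> arrows D), lines = {}\<rparr>"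
  shows "D' \<in> amp_class H" "ADG D'"
proof -
  have c: "chain_graph D" and lD: "lines D = {}" using D(2) by (auto simp: ADG_iff)
  have ad: "\<And>a b. adj D a b \<longleftrightarrow> adj H a b" and tr: "\<And>a b c. triplex D a b c \<longleftrightarrow> triplex H a b c"
    using D(1) by (auto simp: amp_class_iff[OF H])
  note m = chain_graph_mixed[OF c] and mH = chain_graph_mixed[OF H]
  have m': "mixed_graph D'"
    using m mH unfolding mixed_graph_def D'_def
    by (auto simp: asym_iff irrefl_def sym_def)
  let ?R = "arrows H \<union> lines H"
  have sub: "(arrows D')\<^sup>* \<subseteq> ?R\<^sup>*" by (rule rtrancl_mono) (auto simp: D'_def)
  have split: "(x, y) \<in> (arrows D)\<^sup>* \<or> (\<exists>p q. (p, q) \<in> arrows H \<and> (x, p) \<in> ?R\<^sup>* \<and> (q, y) \<in> ?R\<^sup>*)"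
    if "(x, y) \<in> (arrows D')\<^sup>*" for x y
    using that
  proof induction
    case (step y z)
    then have "(y, z) \<in> ?R" "(x, y) \<in> ?R\<^sup>*" using sub by (auto simp: D'_def)
    with step show ?case by (auto simp: D'_def intro: rtrancl_into_rtrancl)
  qed simp
  have "(b, a) \<notin> (arrows D')\<^sup>*" if ab: "(a, b) \<in> arrows D'" for a b
  proof
    assume ba: "(b, a) \<in> (arrows D')\<^sup>*"
    show False
    proof (cases "(a, b) \<in> arrows H")
      case True
      then show False using chain_graphD[OF H] ba sub by blast
    next
      case False
      then have l: "(a, b) \<in> lines H" "(a, b) \<in> arrows D" using ab by (auto simp: D'_def)
      then have "(b, a) \<notin> (arrows D)\<^sup>*" using chain_graphD[OF c] lD by auto
      then obtain p q where pq: "(p, q) \<in> arrows H" "(b, p) \<in> ?R\<^sup>*" "(q, a) \<in> ?R\<^sup>*"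
        using split[OF ba] by blast
      then have "(q, p) \<in> ?R\<^sup>*" using l by (meson UnI2 rtrancl.rtrancl_into_rtrancl rtrancl_trans)
      then show False using chain_graphD[OF H pq(1)] by simp
    qed
  qed
  then have c': "chain_graph D'" using m' by (auto simp: chain_graph_iff D'_def)
  have ad': "adj D' a b \<longleftrightarrow> adj H a b" for a b
    using ad[of a b] lD lines_sym[OF mH, of a b] by (auto simp: adj_def D'_def)
  have "triplex D' a b c \<longleftrightarrow> triplex H a b c" for a b c
  proof -
    have 1: "triplex D' a b c \<longleftrightarrow> a \<noteq> c \<and> \<not> adj H a c \<and> (a, b) \<in> arrows D' \<and> (c, b) \<in> arrows D'"
      unfolding triplex_def ad' by (auto simp: step_def D'_def)
    have 2: "triplex H a b c \<longleftrightarrow> a \<noteq> c \<and> \<not> adj H a c \<and> (a, b) \<in> arrows D \<and> (c, b) \<in> arrows D"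
      unfolding tr[of a b c, symmetric] unfolding triplex_def ad step_def lD by auto
    have 3: "(x, b) \<in> arrows D' \<longleftrightarrow> (x, b) \<in> arrows H \<or> (x, b) \<in> lines H \<and> (x, b) \<in> arrows D" for x
      by (auto simp: D'_def)
    show ?thesis
    proof
      assume "triplex D' a b c"
      then have "a \<noteq> c" "\<not> adj H a c" "(a, b) \<in> arrows D'" "(c, b) \<in> arrows D'" using 1 by blast+
      then show "triplex H a b c" using 2 unfolding 3 by (auto simp: triplex_def step_def)
    next
      assume t: "triplex H a b c"
      then have "step H a b" "step H c b" by (simp_all add: triplex_def)
      then show "triplex D' a b c" using t 2 unfolding 1 3 by (auto simp: step_def)
    qed
  qed
  with c' ad' show "D' \<in> amp_class H" unfolding amp_class_iff[OF H] by (simp add: D'_def)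
  show "ADG D'" using c' by (simp add: ADG_iff D'_def)
qed

text \<open>Triplexes at \<open>v\<close> remain since its lines become arrows towards \<open>v\<close>, and new ones would need
  two nonadjacent vertices joined to \<open>v\<close> by lines. Elsewhere a triplex could only be
  lost at a flag \<open>x \<rightarrow> u - v\<close> with \<open>x\<close> and \<open>v\<close> nonadjacent, which the condition on the parents excludes.\<close>

lemma orient_lines_into_vertex:
  assumes H: "chain_graph H"
    and simplicial: "\<And>u w. (u, v) \<in> lines H \<Longrightarrow> (w, v) \<in> lines H \<Longrightarrow> u \<noteq> w \<Longrightarrow> adj H u w"
    and parents: "\<And>u x. (u, v) \<in> lines H \<Longrightarrow> (x, u) \<in> arrows H \<Longrightarrow> (x, v) \<in> arrows H"
  defines "H' \<equiv> \<lparr>verts = verts H, arrows = arrows H \<union> {(u, w) \<in> lines H. w = v},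
    lines = {(u, w) \<in> lines H. u \<noteq> v \<and> w \<noteq> v}\<rparr>"
  shows "H' \<in> amp_class H"
proof -
  note m = chain_graph_mixed[OF H]
  let ?R = "arrows H \<union> lines H" and ?R' = "arrows H' \<union> lines H'"
  have m': "mixed_graph H'"
    using m unfolding mixed_graph_def H'_def
    by (auto simp: asym_iff irrefl_def sym_def)
  have sub: "?R' \<subseteq> ?R" by (auto simp: H'_def)
  then have sub': "?R'\<^sup>* \<subseteq> ?R\<^sup>*" by (rule rtrancl_mono)
  have "(b, a) \<notin> ?R'\<^sup>*" if ab: "(a, b) \<in> arrows H'" for a b
  proof
    assume ba: "(b, a) \<in> ?R'\<^sup>*"
    show False
    proof (cases "(a, b) \<in> arrows H")
      case True
      then show False using chain_graphD[OF H] ba sub' by blast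
    next
      case False
      then have l: "(a, v) \<in> lines H" "b = v" using ab by (auto simp: H'_def)
      then have "a \<noteq> v" using m by (auto simp: mixed_graph_def dest: irreflD)
      then obtain y where y: "(v, y) \<in> ?R'" "(y, a) \<in> ?R'\<^sup>*"
        using ba l(2) by (metis converse_rtranclE)
      then have vy: "(v, y) \<in> arrows H"
        using m by (auto simp: H'_def mixed_graph_def dest: irreflD)
      have "(y, v) \<in> ?R\<^sup>*" using y(2) sub' l(1) by (meson UnI2 rtrancl.rtrancl_into_rtrancl subsetD)
      then show False using chain_graphD[OF H vy] by simp
    qed
  qed
  then have c': "chain_graph H'" using m' by (simp add: chain_graph_iff)
  have ad: "adj H' a b \<longleftrightarrow> adj H a b" for a b
    using lines_sym[OF m, of a b] by (auto simp: adj_def H'_def)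
  have away: "\<not> triplex H v b c \<or> (v, b) \<in> arrows H" "\<not> triplex H c b v \<or> (v, b) \<in> arrows H" for b c
    using parents[of b c] lines_sym[OF m] arrows_not_lines[OF m]
    by (auto simp: triplex_def step_def adj_def)
  have "triplex H' a b c \<longleftrightarrow> triplex H a b c" for a b c
  proof (cases "b = v")
    case True
    have *: "step H' x v \<longleftrightarrow> step H x v" "(x, v) \<in> arrows H' \<longleftrightarrow> step H x v" for x
      by (auto simp: step_def H'_def)
    show ?thesis using simplicial[of a c] unfolding True triplex_def ad * by (auto simp: step_def)
  next
    case False
    then have *: "(x, b) \<in> arrows H' \<longleftrightarrow> (x, b) \<in> arrows H"
      "(x, b) \<in> lines H' \<longleftrightarrow> (x, b) \<in> lines H \<and> x \<noteq> v" for x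
      by (auto simp: H'_def)
    show ?thesis using away[where b = b and c = c] away[where b = b and c = a] unfolding triplex_def ad step_def * by blast
  qed
  with c' ad show ?thesis unfolding amp_class_iff[OF H] by (simp add: H'_def)
qed

text \<open>Without biflags, the ends of a line have comparable sets of parents: otherwise the line and a
  parent of each end that is not a parent of the other form a 2-biflag. So the vertices next to \<open>K\<close> have
  strictly fewer parents. For two nonadjacent ones \<open>l\<close> and \<open>l'\<close>, choose a parent of \<open>K\<close> missing at \<open>l\<close>
  and one missing at \<open>l'\<close>: depending on whether one of them is missing at both, they give a biflag of
  the first or of the second type on a path through \<open>K\<close>.\<close>

lemma orientable_vertex:
  assumes H: "chain_graph H" and nb: "\<not> has_biflag H" and nh: "\<nexists>vs. hole (lines H) vs"
    and ne: "lines H \<noteq> {}"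
  shows "\<exists>v\<in>Domain (lines H).
    (\<forall>u w. (u, v) \<in> lines H \<longrightarrow> (w, v) \<in> lines H \<longrightarrow> u \<noteq> w \<longrightarrow> adj H u w) \<and>
    (\<forall>u x. (u, v) \<in> lines H \<longrightarrow> (x, u) \<in> arrows H \<longrightarrow> (x, v) \<in> arrows H)"
proof -
  note m = chain_graph_mixed[OF H]
  let ?E = "lines H"
  have symE: "sym ?E" and irrE: "irrefl ?E" and finV: "finite (verts H)"
    and subE: "?E \<subseteq> verts H \<times> verts H" and subA: "arrows H \<subseteq> verts H \<times> verts H"
    using m by (auto simp: mixed_graph_def)
  define pa where "pa u = {x. (x, u) \<in> arrows H}" for u
  have finpa: "finite (pa u)" for u
    using subA by (auto simp: pa_def intro: finite_subset[OF _ finV])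
  have finU: "finite (Domain ?E)" using subE by (auto intro: finite_subset[OF _ finV])
  have "Max ((card \<circ> pa) ` Domain ?E) \<in> (card \<circ> pa) ` Domain ?E" using finU ne by (intro Max_in) auto
  then obtain t where tM: "Max ((card \<circ> pa) ` Domain ?E) = (card \<circ> pa) t" and t: "t \<in> Domain ?E"
    by (rule imageE)
  have tmax: "card (pa u) \<le> card (pa t)" if "u \<in> Domain ?E" for u
    using that finU Max_ge[of "(card \<circ> pa) ` Domain ?E" "card (pa u)"] unfolding tM by auto
  define M where "M = {u. pa u = pa t}"
  define K where "K = (?E \<inter> M \<times> M)\<^sup>* `` {t}"
  define L where "L = {y. y \<notin> K \<and> (\<exists>c\<in>K. (c, y) \<in> ?E)}"
  have tK: "t \<in> K" by (simp add: K_def)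
  have paK: "pa c = pa t" if "c \<in> K" for c
  proof -
    have "(t, c) \<in> (?E \<inter> M \<times> M)\<^sup>*" using that by (simp add: K_def)
    then show ?thesis by (cases rule: rtranclE) (auto simp: M_def)
  qed
  have KU: "K \<subseteq> Domain ?E"
  proof
    fix c assume "c \<in> K"
    then have "(t, c) \<in> (?E \<inter> M \<times> M)\<^sup>*" by (simp add: K_def)
    then show "c \<in> Domain ?E" using t symE by (cases rule: rtranclE) (auto dest: symD)
  qed
  have conn: "(c, d) \<in> (?E \<inter> K \<times> K)\<^sup>*" if "c \<in> K" "d \<in> K" for c d
    using reachable_set_connected[OF symE] that unfolding K_def by blast
  have conn': "(c, d) \<in> ?E\<^sup>*" if "c \<in> K" "d \<in> K" for c d
    using conn[OF that] rtrancl_mono[of "?E \<inter> K \<times> K" ?E] by auto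
  have paL: "pa l \<subset> pa t" if l: "l \<in> L" for l
  proof -
    obtain c where c: "c \<in> K" "(c, l) \<in> ?E" "l \<notin> K" using l by (auto simp: L_def)
    have ne: "pa l \<noteq> pa t"
    proof
      assume "pa l = pa t"
      then have "(c, l) \<in> ?E \<inter> M \<times> M" using c paK by (auto simp: M_def)
      with c(1) have "l \<in> K" by (auto simp: K_def intro: rtrancl_into_rtrancl)
      with c(3) show False by simp
    qed
    have "l \<in> Domain ?E" using c(2) symE by (auto dest: symD)
    then have "\<not> pa t \<subset> pa l" using tmax psubset_card_mono[OF finpa[of l], of "pa t"] by fastforce
    moreover have "pa l \<subseteq> pa t \<or> pa t \<subseteq> pa l"
    proof (rule ccontr)
      assume "\<not> ?thesis"
      then obtain a b where "a \<in> pa t" "a \<notin> pa l" "b \<in> pa l" "b \<notin> pa t" by blast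
      then have ab: "(a, c) \<in> arrows H" "(a, l) \<notin> arrows H" "(b, l) \<in> arrows H" "(b, c) \<notin> arrows H"
        using paK[OF c(1)] by (auto simp: pa_def)
      have lc: "(l, c) \<in> ?E" using c(2) symE by (auto dest: symD)
      have "biflag2 H a b [c, l]"
        using ab c(2) lc parent_outside_component[OF H ab(1), of c]
          parent_outside_component[OF H ab(1), of l] parent_outside_component[OF H ab(3), of c]
          parent_outside_component[OF H ab(3), of l] not_adj_self[OF m] irrE
        by (auto simp: biflag2_def chordless_undirected_path_def less_Suc_eq dest: irreflD)
      then show False using nb by (auto simp: has_biflag_def)
    qed
    ultimately show ?thesis using ne by blast
  qed
  have Lclique: "(l, l') \<in> ?E" if ll: "l \<in> L" "l' \<in> L" "l \<noteq> l'" for l l'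
  proof (rule ccontr)
    assume n: "(l, l') \<notin> ?E"
    obtain c where c: "c \<in> K" "(c, l) \<in> ?E" using ll by (auto simp: L_def)
    obtain d where d: "d \<in> K" "(d, l') \<in> ?E" using ll by (auto simp: L_def)
    obtain f k where f: "2 \<le> k" "f 0 = l" "f k = l'" "inj_on f {..k}"
      "\<And>i. 0 < i \<Longrightarrow> i < k \<Longrightarrow> f i \<in> K" "\<And>i. i < k \<Longrightarrow> (f i, f (Suc i)) \<in> ?E"
      "\<And>i j. i \<le> k \<Longrightarrow> j \<le> k \<Longrightarrow> (f i, f j) \<in> ?E \<Longrightarrow> j = Suc i \<or> i = Suc j"
      using shortest_path_through[OF symE irrE conn c d ll(3) n] by metis
    have fc: "(c, f i) \<in> ?E\<^sup>*" if "i \<le> k" for i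
    proof -
      have "i = 0 \<or> i = k \<or> (0 < i \<and> i < k)" using that by linarith
      then show ?thesis using conn'[OF c(1)] f(2,3,5) c d by (auto intro: rtrancl_into_rtrancl)
    qed
    have "sym (?E\<^sup>*)" using symE by (rule sym_rtrancl)
    then have ff: "(f i, f j) \<in> ?E\<^sup>*" if "i \<le> k" "j \<le> k" for i j
      using fc that by (meson rtrancl_trans symD)
    define cs where "cs = map f [0..<Suc k]"
    have len: "length cs = Suc k" by (simp add: cs_def)
    have nth: "cs ! i = f i" if "i \<le> k" for i using that by (auto simp: cs_def simp del: upt_Suc)
    have "distinct cs" using f(4)
      by (simp add: cs_def distinct_map atLeast0LessThan lessThan_Suc_atMost del: upt_Suc)
    moreover have "(cs ! i, cs ! Suc i) \<in> ?E" if "Suc i < length cs" for i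
      using that f(6) by (simp add: len nth)
    moreover have "j = Suc i \<or> i = Suc j"
      if "i < length cs" "j < length cs" "adj H (cs ! i) (cs ! j)" for i j
      using that f(7)[of i j] component_adj_line[OF H ff, of i j] by (simp add: len nth)
    ultimately have path: "chordless_undirected_path H cs"
      unfolding chordless_undirected_path_def by blast
    have set: "set cs = f ` {..k}"
      by (auto simp: cs_def atLeast0LessThan lessThan_Suc_atMost simp del: upt_Suc)
    have out: "a \<notin> set cs" "\<And>i. i \<le> k \<Longrightarrow> (a, f i) \<notin> arrows H \<Longrightarrow> \<not> adj H a (f i)"
      "\<And>i. 0 < i \<Longrightarrow> i < k \<Longrightarrow> (a, f i) \<in> arrows H" if "a \<in> pa t" for a
    proof -
      have ac: "(a, c) \<in> arrows H" using that paK[OF c(1)] by (auto simp: pa_def)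
      show "a \<notin> set cs" "\<And>i. i \<le> k \<Longrightarrow> (a, f i) \<notin> arrows H \<Longrightarrow> \<not> adj H a (f i)"
        using parent_outside_component[OF H ac fc] unfolding set by blast+
      show "(a, f i) \<in> arrows H" if "0 < i" "i < k" for i
        using paK[OF f(5)[OF that]] \<open>a \<in> pa t\<close> by (auto simp: pa_def)
    qed
    have flag1: False if "x \<in> pa t" "x \<notin> pa l" "x \<notin> pa l'" for x
    proof -
      have "\<not> adj H x (f 0)" "\<not> adj H x (f k)" using out(2)[OF that(1)] that(2,3) f(2,3)
        by (auto simp: pa_def)
      then have "biflag1 H x cs" using path out(1,3)[OF that(1)] f(1) by (simp add: biflag1_def len nth)
      then show False using nb by (auto simp: has_biflag_def)
    qed
    obtain a b where a: "a \<in> pa t" "a \<notin> pa l" and b: "b \<in> pa t" "b \<notin> pa l'"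
      using paL[OF ll(1)] paL[OF ll(2)] by (meson psubsetE subset_iff)
    \<comment> \<open>As \<open>a\<close> is a parent of \<open>l'\<close> only and \<open>b\<close> of \<open>l\<close> only, their roles are swapped: on the path from
      \<open>l\<close> to \<open>l'\<close> it is \<open>b\<close> that points to the first vertex.\<close>
    have al: "a \<in> pa l'" and bl: "b \<in> pa l" using flag1[OF a] flag1[OF b(1) _ b(2)] by argo+
    have "\<not> adj H a (f 0)" "\<not> adj H b (f k)"
      using out(2)[OF a(1), of 0] out(2)[OF b(1), of k] a(2) b(2) f(2,3) by (auto simp: pa_def)
    moreover have "(b, f i) \<in> arrows H" if "i < k" for i
      using out(3)[OF b(1), of i] that bl f(2) by (cases "i = 0") (auto simp: pa_def)
    moreover have "(a, f i) \<in> arrows H" if "0 < i" "i \<le> k" for i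
      using out(3)[OF a(1), of i] that al f(3) by (cases "i = k") (auto simp: pa_def)
    ultimately have "biflag2 H b a cs"
      using path out(1)[OF a(1)] out(1)[OF b(1)] f(1) a bl
      by (auto simp: biflag2_def len nth)
    then show False using nb by (auto simp: has_biflag_def)
  qed
  have "K \<union> L \<subseteq> Domain ?E" using KU symE by (auto simp: L_def dest: symD)
  then have "finite (K \<union> L)" using finU by (rule finite_subset)
  moreover have "L \<subset> K \<union> L" using tK by (auto simp: L_def)
  ultimately have "\<exists>v\<in>K \<union> L - L. \<forall>x\<in>K \<union> L. \<forall>y\<in>K \<union> L.
      (v, x) \<in> ?E \<longrightarrow> (v, y) \<in> ?E \<longrightarrow> x \<noteq> y \<longrightarrow> (x, y) \<in> ?E"
    by (rule simplicial_vertex_outside_clique[OF _ symE irrE nh _ Lclique])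
  then obtain v where v: "v \<in> K \<union> L - L"
    and simp: "\<And>x y. x \<in> K \<union> L \<Longrightarrow> y \<in> K \<union> L \<Longrightarrow> (v, x) \<in> ?E \<Longrightarrow> (v, y) \<in> ?E \<Longrightarrow> x \<noteq> y \<Longrightarrow> (x, y) \<in> ?E"
    by blast
  have vK: "v \<in> K" using v by blast
  have nbr: "u \<in> K \<union> L" "(v, u) \<in> ?E" if "(u, v) \<in> ?E" for u
    using that vK symE by (auto simp: L_def dest: symD)
  show ?thesis
  proof (intro bexI conjI allI impI)
    show "v \<in> Domain ?E" using KU vK by blast
    show "adj H u w" if "(u, v) \<in> ?E" "(w, v) \<in> ?E" "u \<noteq> w" for u w
      using simp[of u w] nbr[OF that(1)] nbr[OF that(2)] that(3) unfolding adj_def by blast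
    show "(x, v) \<in> arrows H" if "(u, v) \<in> ?E" "(x, u) \<in> arrows H" for u x
    proof -
      have "pa u \<subseteq> pa t" using nbr(1)[OF that(1)] paK paL by blast
      then show ?thesis using that(2) paK[OF vK] by (auto simp: pa_def)
    qed
  qed
qed

lemma ADG_in_class:
  assumes "chain_graph G"
    and "\<And>H. H \<in> amp_class G \<Longrightarrow> \<not> has_biflag H" "\<And>H vs. H \<in> amp_class G \<Longrightarrow> \<not> hole (lines H) vs"
  shows "\<exists>D\<in>amp_class G. ADG D"
proof -
  have "\<exists>D\<in>amp_class G. ADG D" if "H \<in> amp_class G" for H
    using that
  proof (induction "card (lines H)" arbitrary: H rule: less_induct)
    case less
    have c: "chain_graph H" using less.prems by (simp add: amp_class_def)
    show ?case
    proof (cases "lines H = {}")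
      case True
      then show ?thesis using c less.prems by (auto simp: ADG_iff)
    next
      case False
      have nh: "\<nexists>vs. hole (lines H) vs" using assms(3)[OF less.prems] by blast
      obtain v where v: "v \<in> Domain (lines H)"
        "\<And>u w. (u, v) \<in> lines H \<Longrightarrow> (w, v) \<in> lines H \<Longrightarrow> u \<noteq> w \<Longrightarrow> adj H u w"
        "\<And>u x. (u, v) \<in> lines H \<Longrightarrow> (x, u) \<in> arrows H \<Longrightarrow> (x, v) \<in> arrows H"
        using orientable_vertex[OF c assms(2)[OF less.prems] nh False] by blast
      define H' where "H' = \<lparr>verts = verts H, arrows = arrows H \<union> {(u, w) \<in> lines H. w = v},
        lines = {(u, w) \<in> lines H. u \<noteq> v \<and> w \<noteq> v}\<rparr>"
      have "H' \<in> amp_class H" unfolding H'_def by (rule orient_lines_into_vertex[OF c v(2,3)])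
      then have H': "H' \<in> amp_class G" unfolding amp_class_eq[OF less.prems] .
      have "lines H \<subseteq> verts H \<times> verts H" "finite (verts H)"
        using chain_graph_mixed[OF c] by (auto simp: mixed_graph_def)
      then have "finite (lines H)" by (meson finite_SigmaI finite_subset)
      moreover have "lines H' \<subset> lines H" using v(1) by (auto simp: H'_def)
      ultimately have "card (lines H') < card (lines H)" by (rule psubset_card_mono)
      then show ?thesis using less.hyps H' by blast
    qed
  qed
  then show ?thesis using amp_class_refl[OF assms(1)] by blast
qed

section \<open>The essential graph\<close>

lemma essential_graph_adj:
  assumes "chain_graph G"
  shows "adj (amp_essential_graph (amp_class G)) a b \<longleftrightarrow> adj G a b"
proof -
  let ?C = "amp_class G"
  have ad: "adj H a b \<longleftrightarrow> adj G a b" if "H \<in> ?C" for H a b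
    using that by (simp add: amp_class_iff[OF assms])
  have ess: "adj G a b" if "(a, b) \<in> amp_essential_arrows ?C" for a b
    using that ad unfolding amp_essential_arrows_def adj_def by blast
  have "(\<exists>H\<in>?C. adj H a b) \<longleftrightarrow> adj G a b" using ad amp_class_refl[OF assms] by blast
  moreover have "adj G a b \<longleftrightarrow> adj G b a" using assms by (intro adj_sym chain_graph_mixed)
  ultimately show ?thesis
    using ess[of a b] ess[of b a] unfolding adj_def[of "amp_essential_graph _"]
    by (auto simp: amp_essential_graph_def)
qed

lemma essential_graph_rigid_line:
  assumes "chain_graph G" "\<And>H. H \<in> amp_class G \<Longrightarrow> (a, b) \<in> lines H"
  shows "(a, b) \<in> lines (amp_essential_graph (amp_class G))"
proof -
  have "(a, b) \<notin> arrows H \<and> (b, a) \<notin> arrows H" if "H \<in> amp_class G" for H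
    using assms(2)[OF that] that arrows_not_lines[of H]
    by (auto simp: amp_class_def dest: chain_graph_mixed)
  moreover have "adj G a b" using assms(2) amp_class_refl[OF assms(1)] by (auto simp: adj_def)
  ultimately show ?thesis using amp_class_refl[OF assms(1)]
    by (auto simp: amp_essential_graph_def amp_essential_arrows_def)
qed

lemma essential_graph_rigid_arrow:
  assumes "chain_graph G" "\<And>H. H \<in> amp_class G \<Longrightarrow> (a, b) \<in> arrows H"
  shows "(a, b) \<in> arrows (amp_essential_graph (amp_class G))"
proof -
  have "(b, a) \<notin> arrows H" if "H \<in> amp_class G" for H
    using assms(2)[OF that] that arrows_asym[of H]
    by (auto simp: amp_class_def dest: chain_graph_mixed)
  then show ?thesis using amp_class_refl[OF assms(1)] assms(2)
    by (auto simp: amp_essential_graph_def amp_essential_arrows_def)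
qed

lemma biflag_in_essential_graph:
  assumes G: "chain_graph G" and H: "H \<in> amp_class G" and b: "has_biflag H"
  shows "has_biflag (amp_essential_graph (amp_class G))"
proof -
  let ?S = "amp_essential_graph (amp_class G)"
  have cH: "chain_graph H" using H by (simp add: amp_class_def)
  note ad = essential_graph_adj[OF G] and line = essential_graph_rigid_line[OF G]
    and arr = essential_graph_rigid_arrow[OF G]
  have adG: "adj H a b \<longleftrightarrow> adj G a b" if "H \<in> amp_class G" for H a b
    using that by (simp add: amp_class_iff[OF G])
  have path: "chordless_undirected_path ?S cs"
    if "\<And>H. H \<in> amp_class G \<Longrightarrow> chordless_undirected_path H cs" for cs
    using that adG[OF H] that[OF H] unfolding chordless_undirected_path_def ad by (auto intro: line)
  have "biflag1 ?S a cs" if "biflag1 H a cs" for a cs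
  proof -
    have all: "biflag1 H' a cs" if "H' \<in> amp_class G" for H'
      using biflag1_invariant[OF cH] that \<open>biflag1 H a cs\<close> amp_class_eq[OF H] by blast
    have "chordless_undirected_path ?S cs" using all by (intro path) (simp add: biflag1_def)
    moreover have "(a, cs ! i) \<in> arrows ?S" if "0 < i \<and> i < length cs - 1" for i
      using all that by (intro arr) (simp add: biflag1_def)
    ultimately show ?thesis using that adG[OF H] by (simp add: biflag1_def ad)
  qed
  moreover have "biflag2 ?S a b cs" if "biflag2 H a b cs" for a b cs
  proof -
    have all: "biflag2 H' a b cs" if "H' \<in> amp_class G" for H'
      using biflag2_invariant[OF cH] that \<open>biflag2 H a b cs\<close> amp_class_eq[OF H] by blast
    have "chordless_undirected_path ?S cs" using all by (intro path) (simp add: biflag2_def)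
    moreover have "(a, cs ! i) \<in> arrows ?S" if "i < length cs - 1" for i
      using all that by (intro arr) (simp add: biflag2_def)
    moreover have "(b, cs ! i) \<in> arrows ?S" if "0 < i \<and> i < length cs" for i
      using all that by (intro arr) (simp add: biflag2_def)
    ultimately show ?thesis using that adG[OF H] by (simp add: biflag2_def ad)
  qed
  ultimately show ?thesis using b unfolding has_biflag_def by blast
qed

lemma hole_in_essential_graph:
  assumes G: "chain_graph G" and H: "H \<in> amp_class G" and h: "hole (lines H) vs"
  shows "\<exists>T\<in>chain_components (amp_essential_graph (amp_class G)).
    \<not> chordal (induced (amp_essential_graph (amp_class G)) T)"
proof -
  let ?S = "amp_essential_graph (amp_class G)" and ?n = "length vs"
  define T where "T = (lines ?S)\<^sup>* `` {vs ! 0}"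
  have cH: "chain_graph H" using H by (simp add: amp_class_def)
  have n4: "4 \<le> ?n" and d: "distinct vs" using h by (auto simp: hole_def)
  have line: "(vs ! i, vs ! (Suc i mod ?n)) \<in> lines ?S" if "i < ?n" for i
    using hole_lines_invariant[OF cH _ h that] amp_class_eq[OF H]
    by (intro essential_graph_rigid_line[OF G]) simp
  have inT: "vs ! i \<in> T" if "i < ?n" for i
    using that
  proof (induction i)
    case (Suc i)
    then have "(vs ! i, vs ! Suc i) \<in> lines ?S" using line[of i] by simp
    with Suc show ?case by (auto simp: T_def intro: rtrancl_into_rtrancl)
  qed (simp add: T_def)
  have "is_cycle (induced ?S T) vs"
    using n4 d line inT by (auto simp: is_cycle_def step_def induced_def intro!: inT mod_less_divisor)
  moreover have "j = Suc i mod ?n \<or> i = Suc j mod ?n"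
    if "i < ?n" "j < ?n" "adj (induced ?S T) (vs ! i) (vs ! j)" for i j
  proof -
    have "adj ?S (vs ! i) (vs ! j)" using that(3) by (auto simp: adj_def induced_def)
    then have "adj H (vs ! i) (vs ! j)" using H by (simp add: essential_graph_adj[OF G] amp_class_iff[OF G])
    then show ?thesis using hole_line_adj[OF cH h] that by blast
  qed
  ultimately have "chordless_cycle (induced ?S T) vs" unfolding chordless_cycle_def by blast
  then have "\<not> chordal (induced ?S T)" using n4 by (auto simp: chordal_def)
  moreover have "vs ! 0 \<in> verts ?S"
  proof -
    have "0 < ?n" using n4 by linarith
    then have "(vs ! 0, vs ! (Suc 0 mod ?n)) \<in> lines H" using h unfolding hole_def by blast
    then have "vs ! 0 \<in> verts H" using chain_graph_mixed[OF cH] by (auto simp: mixed_graph_def)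
    then show ?thesis using H by (auto simp: amp_essential_graph_def)
  qed
  then have "T \<in> chain_components ?S" unfolding chain_components_def T_def by blast
  ultimately show ?thesis by blast
qed

text \<open>The only nontrivial point is that an arrow shared by all ADGs of the class is not reversed in
  any chain graph of the class, because the reversed arrow would be inherited by an ADG.\<close>

lemma essential_graph_of_ADG:
  assumes G: "chain_graph G" and D: "D \<in> amp_class G" "ADG D"
  shows "amp_essential_graph (amp_class G) = adg_essential_graph (adg_class D)"
proof -
  let ?C = "amp_class G"
  have cls: "adg_class D = {H \<in> ?C. ADG H}" using adg_class_eq[OF D(2)] amp_class_eq[OF D(1)] by simp
  have ad: "adj H a b \<longleftrightarrow> adj G a b" and vt: "verts H = verts G" if "H \<in> ?C" for H a b
    using that by (simp_all add: amp_class_iff[OF G])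
  have adD: "adj G a b \<longleftrightarrow> (a, b) \<in> arrows D' \<or> (b, a) \<in> arrows D'" if "D' \<in> ?C" "ADG D'" for D' a b
    using ad[OF that(1), of a b] that(2) by (auto simp: ADG_iff adj_def)
  have asy: "(b, a) \<notin> arrows H" if "H \<in> ?C" "(a, b) \<in> arrows H" for H a b
    using that arrows_asym[of H a b] chain_graph_mixed[of H] by (auto simp: amp_class_def)
  have realise: "\<exists>D'\<in>?C. ADG D' \<and> (a, b) \<in> arrows D'" if "H \<in> ?C" "(a, b) \<in> arrows H" for H a b
  proof -
    have cH: "chain_graph H" using that by (simp add: amp_class_def)
    have "D \<in> amp_class H" using D(1) amp_class_eq[OF that(1)] by simp
    from orient_lines_like_ADG[OF cH this D(2)] show ?thesis
      using amp_class_eq[OF that(1)] that(2) by fastforce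
  qed
  have arr: "(a, b) \<in> amp_essential_arrows ?C \<longleftrightarrow> (\<forall>D'\<in>adg_class D. (a, b) \<in> arrows D')" for a b
  proof
    assume e: "(a, b) \<in> amp_essential_arrows ?C"
    show "\<forall>D'\<in>adg_class D. (a, b) \<in> arrows D'"
    proof
      fix D' assume "D' \<in> adg_class D"
      then have D': "D' \<in> ?C" "ADG D'" by (auto simp: cls)
      obtain H where "H \<in> ?C" "(a, b) \<in> arrows H" using e by (auto simp: amp_essential_arrows_def)
      then have "adj G a b" using ad by (metis adj_def)
      moreover have "(b, a) \<notin> arrows D'" using e D'(1) by (auto simp: amp_essential_arrows_def)
      ultimately show "(a, b) \<in> arrows D'" using adD[OF D'] by blast
    qed
  next
    assume all: "\<forall>D'\<in>adg_class D. (a, b) \<in> arrows D'"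
    then have "(a, b) \<in> arrows D" using D by (auto simp: cls)
    moreover have "(b, a) \<notin> arrows H" if "H \<in> ?C" for H
    proof
      assume "(b, a) \<in> arrows H"
      then obtain D' where "D' \<in> ?C" "ADG D'" "(b, a) \<in> arrows D'"
        using realise[OF \<open>H \<in> ?C\<close>] by blast
      then show False using all asy by (auto simp: cls)
    qed
    ultimately show "(a, b) \<in> amp_essential_arrows ?C"
      using D(1) by (auto simp: amp_essential_arrows_def)
  qed
  have DC: "D \<in> adg_class D" using D by (simp add: cls)
  have lin: "(\<exists>H\<in>?C. adj H a b) \<and> (a, b) \<notin> amp_essential_arrows ?C \<and> (b, a) \<notin> amp_essential_arrows ?C
    \<longleftrightarrow> (\<exists>D'\<in>adg_class D. (a, b) \<in> arrows D') \<and> (\<exists>D'\<in>adg_class D. (b, a) \<in> arrows D')" for a b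
  proof -
    have "(\<exists>H\<in>?C. adj H a b) \<longleftrightarrow> adj G a b" using ad D(1) by blast
    moreover have "adj G a b \<longleftrightarrow> (a, b) \<in> arrows D' \<or> (b, a) \<in> arrows D'"
      "(a, b) \<in> arrows D' \<Longrightarrow> (b, a) \<notin> arrows D'" if "D' \<in> adg_class D" for D'
      using adD asy that by (auto simp: cls)
    ultimately show ?thesis unfolding arr using DC by blast
  qed
  have "(\<Union>H\<in>?C. verts H) = verts G" using vt D(1) by blast
  moreover have "(\<Union>H\<in>adg_class D. verts H) = verts G" using vt DC by (auto simp: cls)
  ultimately show ?thesis unfolding amp_essential_graph_def adg_essential_graph_def
    using arr lin by auto
qed

lemma no_flag_no_biflag:
  assumes "\<And>a b c. (a, b) \<in> arrows S \<Longrightarrow> (b, c) \<in> lines S \<Longrightarrow> a \<noteq> c \<Longrightarrow> adj S a c"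
    and "sym (lines S)"
  shows "\<not> has_biflag S"
proof
  assume "has_biflag S"
  then consider a cs where "biflag1 S a cs" | a b cs where "biflag2 S a b cs"
    by (auto simp: has_biflag_def)
  then show False
  proof cases
    case 1
    then have "cs ! 0 \<in> set cs" by (intro nth_mem) (auto simp: biflag1_def)
    then have "(a, cs ! 1) \<in> arrows S" "(cs ! 0, cs ! 1) \<in> lines S" "a \<noteq> cs ! 0"
      "\<not> adj S a (cs ! 0)"
      using 1 by (auto simp: biflag1_def chordless_undirected_path_def)
    then show False using assms by (meson symD)
  next
    case 2
    then obtain k where k: "length cs = Suc (Suc k)"
      by (auto simp: biflag2_def numeral_2_eq_2 Suc_le_eq less_iff_Suc_add)
    have "cs ! Suc k \<in> set cs" using k by simp
    then have "(a, cs ! k) \<in> arrows S" "(cs ! k, cs ! Suc k) \<in> lines S" "a \<noteq> cs ! Suc k"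
      "\<not> adj S a (cs ! Suc k)"
      using 2 k by (auto simp: biflag2_def chordless_undirected_path_def)
    then show False using assms(1) by blast
  qed
qed

text \<open>The line is oriented in both ways by ADGs of the class, and the triplex that one of the
  orientations produces with \<open>a \<rightarrow> b\<close> excludes the other.\<close>

lemma adg_essential_graph_no_flag:
  assumes "ADG D" "(a, b) \<in> arrows (adg_essential_graph (adg_class D))"
    "(b, c) \<in> lines (adg_essential_graph (adg_class D))" "a \<noteq> c"
  shows "adj D a c"
proof (rule ccontr)
  assume n: "\<not> adj D a c"
  obtain D1 D2 where D12: "D1 \<in> adg_class D" "(b, c) \<in> arrows D1" "D2 \<in> adg_class D" "(c, b) \<in> arrows D2"
    using assms(3) by (auto simp: adg_essential_graph_def)
  have cD: "chain_graph D" using assms(1) by (simp add: ADG_iff)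
  have D12': "D1 \<in> amp_class D" "D2 \<in> amp_class D" using D12 adg_class_eq[OF assms(1)] by auto
  have "(a, b) \<in> arrows D2" using assms(2) D12(3) by (auto simp: adg_essential_graph_def)
  then have "triplex D2 a b c"
    using n D12' D12(4) assms(4) by (auto simp: triplex_def step_def amp_class_iff[OF cD])
  then have "triplex D1 a b c" using D12' by (simp add: amp_class_iff[OF cD])
  moreover have "mixed_graph D1" using D12' by (simp add: amp_class_def chain_graph_mixed)
  ultimately show False using triplex_no_arrow_out D12(2) by metis
qed

text \<open>The cycle is taken in the essential graph, but it is studied in \<open>D\<close>, which is acyclic and hence
  has a triplex on it. A triplex is shared by all ADGs of the class, so the edge that leaves its middle
  vertex along the cycle can be neither an arrow from that vertex nor a line.\<close>

lemma adg_essential_graph_chordal: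
  assumes D: "ADG D"
  shows "chordal (induced (adg_essential_graph (adg_class D)) T)"
proof (rule ccontr)
  let ?S = "adg_essential_graph (adg_class D)"
  assume "\<not> ?thesis"
  then obtain vs where n4: "4 \<le> length vs" and cyc: "is_cycle (induced ?S T) vs"
    and chord: "\<And>i j. i < length vs \<Longrightarrow> j < length vs \<Longrightarrow> adj (induced ?S T) (vs ! i) (vs ! j)
      \<Longrightarrow> j = Suc i mod length vs \<or> i = Suc j mod length vs"
    by (auto simp: chordal_def chordless_cycle_def)
  let ?n = "length vs"
  have d: "distinct vs" and st: "\<And>i. i < ?n \<Longrightarrow> step (induced ?S T) (vs ! i) (vs ! (Suc i mod ?n))"
    using cyc by (auto simp: is_cycle_def)
  have cD: "chain_graph D" and lD: "lines D = {}" using D by (auto simp: ADG_iff)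
  have lt: "j mod ?n < ?n" for j using n4 by (intro mod_less_divisor) linarith
  have adS: "adj ?S a b \<longleftrightarrow> adj D a b" for a b
    using essential_graph_of_ADG[OF cD amp_class_refl[OF cD] D] essential_graph_adj[OF cD] by metis
  have inT: "vs ! j \<in> T" if "j < ?n" for j
    using st[OF that] by (auto simp: step_def induced_def)
  have adT: "adj (induced ?S T) (vs ! i) (vs ! j) \<longleftrightarrow> adj D (vs ! i) (vs ! j)"
    if "i < ?n" "j < ?n" for i j
    using inT[OF that(1)] inT[OF that(2)] unfolding adS[symmetric] by (auto simp: adj_def induced_def)
  note apart = chordless_cycle_two_apart[OF n4 d, where P = "adj D", OF _ chord[unfolded adT]]
  \<comment> \<open>Without triplexes the cycle would consist of lines, which \<open>D\<close> does not have.\<close>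
  have "(vs ! 0, vs ! (Suc 0 mod ?n)) \<in> lines D"
  proof (rule triplex_free_cycle_undirected[OF cD])
    show "0 < ?n" using n4 by linarith
  next
    fix j assume j: "j < ?n"
    let ?a = "vs ! j" and ?b = "vs ! (Suc j mod ?n)" and ?c = "vs ! (Suc (Suc j) mod ?n)"
    show "adj D ?a ?b"
      using st[OF j] adT[OF j lt[of "Suc j"]] by (auto simp: step_def adj_def)
    show "?a \<noteq> ?c" "\<not> adj D ?a ?c" using apart[OF j] adT by blast+
    show "\<not> triplex D ?a ?b ?c"
    proof
      assume t: "triplex D ?a ?b ?c"
      have "(?b, ?c) \<notin> arrows D'" if "D' \<in> adg_class D" for D'
      proof -
        have "D' \<in> amp_class D" using that adg_class_eq[OF D] by auto
        then have "triplex D' ?a ?b ?c" "mixed_graph D'"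
          using t by (auto simp: amp_class_iff[OF cD] chain_graph_mixed)
        then show ?thesis by (rule triplex_no_arrow_out)
      qed
      moreover have "D \<in> adg_class D" using D by (simp add: adg_class_def)
      ultimately have "\<not> step ?S ?b ?c" by (auto simp: step_def adg_essential_graph_def)
      then show False using st[OF lt[of "Suc j"]] by (auto simp: mod_Suc_eq step_def induced_def)
    qed
  qed
  then show False using lD by simp
qed

theorem proposition4p2:
  fixes G :: "'a mixed_graph"
    and \<G> :: "'a mixed_graph set"
    and G_star :: "'a mixed_graph"
  assumes "chain_graph G"
    and "\<G> = amp_class G"
    and "G_star = amp_essential_graph \<G>"
  shows "((\<exists>D\<^sub>0\<in>\<G>. ADG D\<^sub>0) \<longleftrightarrow>
            \<not> has_biflag G_star \<and> (\<forall>T\<in>chain_components G_star. chordal (induced G_star T)))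
       \<and> (\<forall>D\<^sub>0\<in>\<G>. ADG D\<^sub>0 \<longrightarrow> G_star = adg_essential_graph (adg_class D\<^sub>0))"
proof (intro conjI iffI)
  have eq: "G_star = adg_essential_graph (adg_class D)" if "D \<in> \<G>" "ADG D" for D
    using essential_graph_of_ADG[OF assms(1)] that by (simp add: assms(2,3))
  then show "\<forall>D\<^sub>0\<in>\<G>. ADG D\<^sub>0 \<longrightarrow> G_star = adg_essential_graph (adg_class D\<^sub>0)" by blast
  {
    assume "\<exists>D\<^sub>0\<in>\<G>. ADG D\<^sub>0"
    then obtain D where D: "D \<in> \<G>" "ADG D" by blast
    note S = eq[OF D]
    have "adj G_star a c" if "(a, b) \<in> arrows G_star" "(b, c) \<in> lines G_star" "a \<noteq> c" for a b c
    proof -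
      have "adj D a c" using adg_essential_graph_no_flag[OF D(2)] that unfolding S .
      then show ?thesis using D(1)
        by (simp add: assms(2,3) essential_graph_adj[OF assms(1)] amp_class_iff[OF assms(1)])
    qed
    moreover have "sym (lines G_star)" unfolding S by (auto simp: adg_essential_graph_def sym_def)
    ultimately show "\<not> has_biflag G_star" by (rule no_flag_no_biflag)
    show "\<forall>T\<in>chain_components G_star. chordal (induced G_star T)"
      using adg_essential_graph_chordal[OF D(2)] by (simp add: S)
  }
  assume "\<not> has_biflag G_star \<and> (\<forall>T\<in>chain_components G_star. chordal (induced G_star T))"
  then show "\<exists>D\<^sub>0\<in>\<G>. ADG D\<^sub>0"
    using ADG_in_class[OF assms(1)] biflag_in_essential_graph[OF assms(1)]
      hole_in_essential_graph[OF assms(1)] unfolding assms(2,3) by blast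
qed

end
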